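(* Let $M$ be a simple matroid which is graphic or cographic, and let $c$ be a $2$-uniform $(r(M)+1)$-colouring of $M$. Then $(M,c)$ has a short rainbow circuit $4$-tuple, i.e. rainbow circuits $C_1,\dots,C_4$ of $M$ (not necessarily distinct) with $\sum_{i=1}^4|C_i|\le 2r(M)+4$ such that no element of $E(M)$ lies in more than two of them (counted with multiplicity).
   Context: A $k$-colouring of a matroid $M$ is a function $c:E(M)\to[k]=\{1,\dots,k\}$; it is $2$-uniform if every colour class $c^{-1}(s)$ has exactly two elements. A rainbow circuit is a circuit on which $c$ is injective. *)

theory Defs
  imports Main "HOL-Library.FuncSet"
begin

section \<open>Matroids\<close>

record 'a pre_matroid =
  ground :: "'a set"
  indeps :: "'a set set"

locale matroid =
  fixes M :: "'a pre_matroid"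
  assumes finite_ground: "finite (ground M)"
    and indep_subset_ground: "I \<in> indeps M \<Longrightarrow> I \<subseteq> ground M"
    and indep_empty: "{} \<in> indeps M"
    and indep_subset: "I \<in> indeps M \<Longrightarrow> J \<subseteq> I \<Longrightarrow> J \<in> indeps M"
    and indep_augment: "I \<in> indeps M \<Longrightarrow> J \<in> indeps M \<Longrightarrow> card I < card J \<Longrightarrow>
      \<exists>x \<in> J - I. insert x I \<in> indeps M"

definition circuit :: "'a pre_matroid \<Rightarrow> 'a set \<Rightarrow> bool" where
  "circuit M C \<longleftrightarrow> C \<subseteq> ground M \<and> C \<notin> indeps M \<and> (\<forall>D. D \<subset> C \<longrightarrow> D \<in> indeps M)"

definition basis :: "'a pre_matroid \<Rightarrow> 'a set \<Rightarrow> bool" where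
  "basis M B \<longleftrightarrow> B \<in> indeps M \<and> (\<forall>I \<in> indeps M. B \<subseteq> I \<longrightarrow> I = B)"

definition rank_of :: "'a pre_matroid \<Rightarrow> 'a set \<Rightarrow> nat" where
  "rank_of M X = Max (card ` {I \<in> indeps M. I \<subseteq> X})"

definition matroid_rank :: "'a pre_matroid \<Rightarrow> nat" where
  "matroid_rank M = rank_of M (ground M)"

definition loop :: "'a pre_matroid \<Rightarrow> 'a \<Rightarrow> bool" where
  "loop M e \<longleftrightarrow> circuit M {e}"

definition parallel :: "'a pre_matroid \<Rightarrow> 'a \<Rightarrow> 'a \<Rightarrow> bool" where
  "parallel M e f \<longleftrightarrow> e \<noteq> f \<and> circuit M {e, f}"

definition simple_matroid :: "'a pre_matroid \<Rightarrow> bool" where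
  "simple_matroid M \<longleftrightarrow> (\<nexists>e. loop M e) \<and> (\<nexists>e f. parallel M e f)"

text \<open>The bases of the dual are the complements of the bases, so its independent sets are the
  sets of elements avoiding some basis.\<close>

definition dual :: "'a pre_matroid \<Rightarrow> 'a pre_matroid" where
  "dual M = \<lparr> ground = ground M,
              indeps = {I. \<exists>B. basis M B \<and> I \<subseteq> ground M - B} \<rparr>"

definition isomorphic :: "'a pre_matroid \<Rightarrow> 'b pre_matroid \<Rightarrow> bool" where
  "isomorphic M N \<longleftrightarrow> (\<exists>f. bij_betw f (ground M) (ground N) \<and>
     (\<forall>I. I \<subseteq> ground M \<longrightarrow> (I \<in> indeps M \<longleftrightarrow> f ` I \<in> indeps N)))"

section \<open>Graphic and cographic matroids\<close>

text \<open>Finite undirected graphs; loops (one end) and parallel edges are allowed.\<close>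

record ('v, 'e) pre_multigraph =
  vertices :: "'v set"
  edges :: "'e set"
  ends :: "'e \<Rightarrow> 'v set"

locale multigraph =
  fixes G :: "('v, 'e) pre_multigraph"
  assumes finite_vertices: "finite (vertices G)"
    and finite_edges: "finite (edges G)"
    and ends_subset: "e \<in> edges G \<Longrightarrow> ends G e \<subseteq> vertices G"
    and card_ends: "e \<in> edges G \<Longrightarrow> card (ends G e) = 1 \<or> card (ends G e) = 2"

text \<open>Edge sets of cycles. A loop is a cycle of length 1, a pair of parallel edges one of length 2
  (this is the only length for which distinctness of the edges is not implied by that of the
  vertices).\<close>

definition cycle_edges :: "('v, 'e) pre_multigraph \<Rightarrow> 'e set \<Rightarrow> bool" where
  "cycle_edges G C \<longleftrightarrow> (\<exists>vs es. es \<noteq> [] \<and> length vs = length es \<and> distinct vs \<and> distinct es \<and>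
     set es = C \<and> C \<subseteq> edges G \<and>
     (\<forall>i < length es. ends G (es ! i) = {vs ! i, vs ! (Suc i mod length es)}))"

definition cycle_matroid :: "('v, 'e) pre_multigraph \<Rightarrow> 'e pre_matroid" where
  "cycle_matroid G = \<lparr> ground = edges G,
                       indeps = {I. I \<subseteq> edges G \<and> (\<nexists>C. cycle_edges G C \<and> C \<subseteq> I)} \<rparr>"

text \<open>A finite graph can be relabelled to have natural numbers as vertices and edges, so fixing
  these types loses no generality.\<close>

definition graphic :: "'a pre_matroid \<Rightarrow> bool" where
  "graphic M \<longleftrightarrow> (\<exists>G :: (nat, nat) pre_multigraph. multigraph G \<and> isomorphic M (cycle_matroid G))"

definition cographic :: "'a pre_matroid \<Rightarrow> bool" where
  "cographic M \<longleftrightarrow> graphic (dual M)"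

section \<open>Colourings and rainbow circuits\<close>

definition colouring :: "'a pre_matroid \<Rightarrow> nat \<Rightarrow> ('a \<Rightarrow> nat) \<Rightarrow> bool" where
  "colouring M k c \<longleftrightarrow> c \<in> ground M \<rightarrow> {1..k}"

definition two_uniform :: "'a pre_matroid \<Rightarrow> nat \<Rightarrow> ('a \<Rightarrow> nat) \<Rightarrow> bool" where
  "two_uniform M k c \<longleftrightarrow> (\<forall>s \<in> {1..k}. card {e \<in> ground M. c e = s} = 2)"

definition rainbow_circuit :: "'a pre_matroid \<Rightarrow> ('a \<Rightarrow> nat) \<Rightarrow> 'a set \<Rightarrow> bool" where
  "rainbow_circuit M c C \<longleftrightarrow> circuit M C \<and> inj_on c C"

definition short_rainbow_circuit_4_tuple ::
  "'a pre_matroid \<Rightarrow> ('a \<Rightarrow> nat) \<Rightarrow> (nat \<Rightarrow> 'a set) \<Rightarrow> bool" where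
  "short_rainbow_circuit_4_tuple M c C \<longleftrightarrow>
     (\<forall>i \<in> {1..4}. rainbow_circuit M c (C i)) \<and>
     (\<Sum>i = 1..4. card (C i)) \<le> 2 * matroid_rank M + 4 \<and>
     (\<forall>e \<in> ground M. card {i \<in> {1..4}. e \<in> C i} \<le> 2)"

end

theory Submission
  imports Defs "HOL-Library.Disjoint_Sets"
begin

text \<open>
  Work in the cycle space over the two-element field: a nonempty edge set all of whose degrees are
  even contains a cycle, and a set with at least as many edges as vertices contains such a set.

  Graphic case. A representing graph with as few vertices as possible is connected, so it has at
  most as many vertices as there are colours.

  Suppose some rainbow edge set has a cycle space of dimension at least two, and let \<open>S\<close> be a smallest
  one. Unless it contains two disjoint cycles, \<open>S\<close> is a theta graph; its three cycles cover it twice.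
  Choosing for each colour an edge outside \<open>S\<close> gives as many edges as vertices, hence a fourth cycle.
  If no edge of it joins two vertices of \<open>S\<close>, its length is at most twice the number of vertices
  missed by \<open>S\<close>, and the four lengths add up as required. By minimality of \<open>S\<close> at most two edges of
  the fourth cycle are chords of \<open>S\<close>, and each of them either shortens one of the three cycles or
  splits one of them into two rainbow cycles.

  Otherwise deleting any vertex must destroy a colour, so every vertex is the centre of a colour
  class, and the classes form a digraph with all outdegrees two in which directed cycles are
  rainbow. By a theorem of Thomassen it has two directed cycles with exactly one common vertex; each
  is taken twice.

  Cographic case. Merge the vertices of the graph of the dual as long as both edges of some colour
  join the same two blocks. Then each colour class lies in at most one vertex cut, there are at
  least two more blocks than colours, and the cuts have average size less than four. Some two
  of the blocks with rainbow cuts are nonadjacent, since there are too few colours to join all pairs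
  of them; their cuts are taken twice.
\<close>

section \<open>Digraphs of minimum outdegree two\<close>

definition out_boundary :: "('v \<Rightarrow> 'v set) \<Rightarrow> 'v set \<Rightarrow> 'v set" where
  "out_boundary N X = \<Union>(N ` X) - X"

definition sinkless :: "('v \<Rightarrow> 'v set) \<Rightarrow> 'v set \<Rightarrow> bool" where
  "sinkless N K \<longleftrightarrow> (\<forall>x\<in>K. N x \<inter> K \<noteq> {})"

lemma two_le_card_iff_not_subset_singleton:
  assumes "finite A"
  shows "2 \<le> card A \<longleftrightarrow> (\<forall>s. \<not> A \<subseteq> {s})"
proof -
  have "card A \<le> 1 \<longleftrightarrow> (\<exists>s. A \<subseteq> {s})"
    unfolding One_nat_def card_le_Suc0_iff_eq[OF assms] by blast
  then show ?thesis by (metis Suc_1 not_less_eq_eq One_nat_def)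
qed

lemma out_boundary_submodular:
  assumes "finite (out_boundary N X)" "finite (out_boundary N Y)"
  shows "card (out_boundary N (X \<inter> Y)) + card (out_boundary N (X \<union> Y))
    \<le> card (out_boundary N X) + card (out_boundary N Y)"
proof -
  let ?P = "out_boundary N (X \<inter> Y)" and ?Q = "out_boundary N (X \<union> Y)"
  have union: "?P \<union> ?Q \<subseteq> out_boundary N X \<union> out_boundary N Y"
    and inter: "?P \<inter> ?Q \<subseteq> out_boundary N X \<inter> out_boundary N Y"
    by (auto simp: out_boundary_def)
  have fin: "finite ?P" "finite ?Q"
    using union assms finite_subset[of "?P \<union> ?Q"] by auto
  have "card ?P + card ?Q = card (?P \<union> ?Q) + card (?P \<inter> ?Q)"
    using fin by (rule card_Un_Int)
  also have
    "\<dots> \<le> card (out_boundary N X \<union> out_boundary N Y) + card (out_boundary N X \<inter> out_boundary N Y)"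
    using union inter assms by (intro add_mono card_mono) auto
  also have "\<dots> = card (out_boundary N X) + card (out_boundary N Y)"
    using card_Un_Int[OF assms] by simp
  finally show ?thesis .
qed

text \<open>With \<open>R\<close> the complement of a target set, this is the hypothesis of Menger's theorem for paths
  from \<open>y\<close> to the targets that meet only in \<open>y\<close>.\<close>

definition linked :: "nat \<Rightarrow> 'v \<Rightarrow> 'v set \<Rightarrow> ('v \<Rightarrow> 'v set) \<Rightarrow> bool" where
  "linked k y R N \<longleftrightarrow> (\<forall>X. y \<in> X \<longrightarrow> X \<subseteq> R \<longrightarrow> k \<le> card (out_boundary N X))"

lemma linkedD: "linked k y R N \<Longrightarrow> y \<in> X \<Longrightarrow> X \<subseteq> R \<Longrightarrow> k \<le> card (out_boundary N X)"
  by (simp add: linked_def)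

lemma finite_out_boundary:
  assumes "finite R" "\<And>x. x \<in> R \<Longrightarrow> finite (N x)" "X \<subseteq> R"
  shows "finite (out_boundary N X)"
  using assms finite_subset[OF assms(3,1)] by (auto simp: out_boundary_def)

lemma tight_set_at_critical_arc:
  assumes linked: "linked k y R N" and critical: "\<not> linked k y R (N(x := N x - {u}))"
    and fin: "finite R" "\<And>x. x \<in> R \<Longrightarrow> finite (N x)"
  shows "\<exists>X. y \<in> X \<and> x \<in> X \<and> X \<subseteq> R \<and> u \<notin> X \<and> card (out_boundary N X) = k \<and> u \<notin> \<Union>(N ` (X - {x}))"
proof -
  let ?N = "N(x := N x - {u})"
  obtain X where X: "y \<in> X" "X \<subseteq> R" "card (out_boundary ?N X) < k"
    using critical by (auto simp: linked_def not_le)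
  have ge: "k \<le> card (out_boundary N X)" using linkedD[OF linked X(1,2)] .
  have sub: "out_boundary ?N X \<subseteq> out_boundary N X"
    and sup: "out_boundary N X \<subseteq> insert u (out_boundary ?N X)"
    by (auto simp: out_boundary_def split: if_splits)
  have "out_boundary N X \<noteq> out_boundary ?N X" using X(3) ge by auto
  then have u: "u \<in> out_boundary N X" "u \<notin> out_boundary ?N X" using sub sup by auto
  have "finite (out_boundary ?N X)"
    using finite_subset[OF sub finite_out_boundary[OF fin X(2)]] .
  then have "card (out_boundary N X) \<le> Suc (card (out_boundary ?N X))"
    using card_mono[OF _ sup] u by simp
  then have "card (out_boundary N X) = k" using ge X(3) by linarith
  moreover have "u \<notin> X" "u \<notin> \<Union>(N ` (X - {x}))"
    using u by (fastforce simp: out_boundary_def)+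
  moreover from this have "x \<in> X" using u(1) by (auto simp: out_boundary_def)
  ultimately show ?thesis using X(1,2) by blast
qed

text \<open>By submodularity the intersection of the two sets is tight as well; without \<open>x\<close> its boundary
  loses both \<open>u\<close> and \<open>v\<close> and gains only \<open>x\<close>.\<close>

lemma unique_critical_arc:
  assumes linked: "linked k y R N" and fin: "finite R" "\<And>x. x \<in> R \<Longrightarrow> finite (N x)"
    and X: "y \<in> X" "x \<in> X" "X \<subseteq> R" "u \<notin> X" "card (out_boundary N X) = k" "u \<notin> \<Union>(N ` (X - {x}))"
    and Y: "y \<in> Y" "x \<in> Y" "Y \<subseteq> R" "v \<notin> Y" "card (out_boundary N Y) = k" "v \<notin> \<Union>(N ` (Y - {x}))"
    and arcs: "u \<in> N x" "v \<in> N x" and "x \<noteq> y"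
  shows "u = v"
proof (rule ccontr)
  assume "u \<noteq> v"
  let ?Z = "X \<inter> Y"
  have fin_boundary: "finite (out_boundary N A)" if "A \<subseteq> R" for A
    using finite_out_boundary[OF fin that] .
  have "k \<le> card (out_boundary N (X \<union> Y))"
    using X(1,3) Y(3) by (intro linkedD[OF linked]) auto
  then have "card (out_boundary N ?Z) \<le> k"
    using out_boundary_submodular[OF fin_boundary[OF X(3)] fin_boundary[OF Y(3)]] X(5) Y(5)
    by linarith
  moreover have uv: "{u, v} \<subseteq> out_boundary N ?Z" using X Y arcs by (auto simp: out_boundary_def)
  moreover have "out_boundary N (?Z - {x}) \<subseteq> insert x (out_boundary N ?Z - {u, v})"
    using X(6) Y(6) by (auto simp: out_boundary_def)
  moreover have fin_Z: "finite (out_boundary N ?Z)" using X(3) by (intro fin_boundary) auto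
  moreover have "2 \<le> card (out_boundary N ?Z)"
    using card_mono[OF fin_Z uv] \<open>u \<noteq> v\<close> by simp
  ultimately have "card (out_boundary N (?Z - {x})) < k"
    using card_mono[of "insert x (out_boundary N ?Z - {u, v})" "out_boundary N (?Z - {x})"]
      card_insert_le_m1[of "card (out_boundary N ?Z) - 1" "out_boundary N ?Z - {u, v}" x] \<open>u \<noteq> v\<close>
    by (simp add: card_Diff_subset)
  moreover have "k \<le> card (out_boundary N (?Z - {x}))"
    using X(1,3) Y(1) \<open>x \<noteq> y\<close> by (intro linkedD[OF linked]) auto
  ultimately show False by linarith
qed

lemma linked_thinning:
  assumes linked: "linked k y R N" and fin: "finite R" "\<And>x. x \<in> R \<Longrightarrow> finite (N x)"
  shows "\<exists>N'. (\<forall>x. N' x \<subseteq> N x) \<and> linked k y R N' \<and> (\<forall>x\<in>R - {y}. \<forall>u\<in>N' x. \<forall>v\<in>N' x. u = v)"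
proof -
  define admissible where "admissible N' \<longleftrightarrow> (\<forall>x. N' x \<subseteq> N x) \<and> linked k y R N'" for N'
  have "admissible N" using linked by (simp add: admissible_def)
  then obtain N' where N': "admissible N'"
    and least: "\<And>N''. admissible N'' \<Longrightarrow> (\<Sum>x\<in>R. card (N' x)) \<le> (\<Sum>x\<in>R. card (N'' x))"
    using ex_has_least_nat[of admissible N "\<lambda>N'. \<Sum>x\<in>R. card (N' x)"] by blast
  have linked': "linked k y R N'" and sub: "N' x \<subseteq> N x" for x
    using N' by (auto simp: admissible_def)
  have finN': "finite (N' x)" if "x \<in> R" for x using fin(2)[OF that] sub finite_subset by blast
  have critical: "\<not> linked k y R (N'(x := N' x - {u}))" if "x \<in> R" "u \<in> N' x" for x u
  proof
    let ?N = "N'(x := N' x - {u})"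
    assume "linked k y R ?N"
    then have "admissible ?N" using sub by (auto simp: admissible_def)
    then have "(\<Sum>z\<in>R. card (N' z)) \<le> (\<Sum>z\<in>R. card (?N z))" by (rule least)
    moreover have "(\<Sum>z\<in>R. card (?N z)) < (\<Sum>z\<in>R. card (N' z))"
      using that finN'
      by (intro sum_strict_mono_ex1[OF fin(1)])
        (auto intro!: bexI[of _ x] card_Diff1_less card_Diff1_le
          simp del: card_Diff_singleton card_Diff_insert)
    ultimately show False by simp
  qed
  have "u = v" if x: "x \<in> R - {y}" and uv: "u \<in> N' x" "v \<in> N' x" for x u v
  proof -
    obtain X where X: "y \<in> X" "x \<in> X" "X \<subseteq> R" "u \<notin> X" "card (out_boundary N' X) = k"
      "u \<notin> \<Union>(N' ` (X - {x}))"
      using tight_set_at_critical_arc[OF linked' critical fin(1) finN'] x uv by blast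
    obtain Y where Y: "y \<in> Y" "x \<in> Y" "Y \<subseteq> R" "v \<notin> Y" "card (out_boundary N' Y) = k"
      "v \<notin> \<Union>(N' ` (Y - {x}))"
      using tight_set_at_critical_arc[OF linked' critical fin(1) finN'] x uv by blast
    show ?thesis using unique_critical_arc[OF linked' fin(1) finN' X Y uv] x by blast
  qed
  then show ?thesis using linked' sub by blast
qed

definition reaching :: "('v \<Rightarrow> 'v set) \<Rightarrow> 'v set \<Rightarrow> 'v \<Rightarrow> 'v set" where
  "reaching N R t = {x. (x, t) \<in> {(x, x'). x \<in> R \<and> x' \<in> N x}\<^sup>*}"

lemma reaching_self: "t \<in> reaching N R t"
  by (simp add: reaching_def)

lemma reaching_back: "x \<in> R \<Longrightarrow> x' \<in> N x \<Longrightarrow> x' \<in> reaching N R t \<Longrightarrow> x \<in> reaching N R t"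
  by (auto simp: reaching_def intro: converse_rtrancl_into_rtrancl)

lemma reaching_step:
  assumes "x \<in> reaching N R t" "x \<noteq> t"
  shows "x \<in> R" "N x \<inter> reaching N R t \<noteq> {}"
  using assms by (auto simp: reaching_def elim: converse_rtranclE)

lemma disjoint_reaching:
  assumes unique: "\<And>x u v. x \<in> R \<Longrightarrow> u \<in> N x \<Longrightarrow> v \<in> N x \<Longrightarrow> u = v"
  shows "disjoint_family_on (reaching N R) (- R)"
proof -
  have "single_valued {(x, x'). x \<in> R \<and> x' \<in> N x}"
    using unique by (auto simp: single_valued_def)
  moreover have "t' = t" if "t' \<in> - R" "(t', t) \<in> {(x, x'). x \<in> R \<and> x' \<in> N x}\<^sup>*" for t t'
    using that by (auto elim: converse_rtranclE)
  ultimately show ?thesis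
    unfolding disjoint_family_on_def reaching_def by (blast dest: single_valued_confluent)
qed

lemma card_fan_targets:
  assumes fin: "finite W" and R: "R \<subseteq> W" "\<And>x. x \<in> R \<Longrightarrow> N x \<subseteq> W" and y: "y \<in> R"
    and linked: "linked k y R N"
    and unique: "\<And>x u v. x \<in> R - {y} \<Longrightarrow> u \<in> N x \<Longrightarrow> v \<in> N x \<Longrightarrow> u = v"
  shows "k \<le> card {t\<in>W - R. N y \<inter> reaching N (R - {y}) t \<noteq> {}}" (is "_ \<le> card ?T")
proof -
  let ?K = "reaching N (R - {y})"
  define F where "F = \<Union>(?K ` (W - R))"
  let ?X = "(R - F) \<union> (\<Union>t\<in>?T. ?K t - {t})"
  have "out_boundary N ?X \<subseteq> ?T"
  proof
    fix v assume "v \<in> out_boundary N ?X"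
    then obtain x where x: "x \<in> ?X" "v \<in> N x" "v \<notin> ?X" by (auto simp: out_boundary_def)
    show "v \<in> ?T"
    proof (cases "x \<in> R - F")
      case True
      then have "v \<in> W" using x(2) R(2) by blast
      then have "v \<in> F" using x(3) by (auto simp: F_def intro: reaching_self)
      then have "x = y" using True x(2) reaching_back[of x "R - {y}" v N] by (auto simp: F_def)
      then obtain t where "t \<in> ?T" "v \<in> ?K t" using x(2) \<open>v \<in> F\<close> by (auto simp: F_def)
      then show ?thesis using x(3) by auto
    next
      case False
      then obtain t where t: "t \<in> ?T" "x \<in> ?K t" "x \<noteq> t" using x by auto
      then have "v \<in> ?K t" using reaching_step[OF t(2,3)] unique[of x] x(2) by blast
      then show ?thesis using t x(3) by auto
    qed
  qed
  moreover have "finite ?T" using fin by simp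
  ultimately have "card (out_boundary N ?X) \<le> card ?T" by (simp add: card_mono)
  moreover have "y \<notin> F" using y reaching_step(1)[of y N "R - {y}"] by (auto simp: F_def)
  then have "k \<le> card (out_boundary N ?X)"
    using y reaching_step(1)[of _ N "R - {y}"] by (intro linkedD[OF linked]) blast+
  ultimately show ?thesis by linarith
qed

text \<open>Menger's theorem for paths from \<open>y\<close> to \<open>W - R\<close> that meet only in \<open>y\<close>, with each path replaced by
  a set \<open>K t\<close> that contains an out-neighbour of each of its vertices but its target \<open>t\<close>. After
  thinning, \<open>K t\<close> consists of the vertices from which the unique arcs lead to \<open>t\<close>.\<close>

theorem menger_fan:
  assumes fin: "finite W" and R: "R \<subseteq> W" "\<And>x. x \<in> R \<Longrightarrow> N x \<subseteq> W" and y: "y \<in> R"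
    and linked: "linked k y R N"
  shows "\<exists>T K. T \<subseteq> W - R \<and> k \<le> card T \<and> disjoint_family_on K T \<and>
    (\<forall>t\<in>T. t \<in> K t \<and> K t \<subseteq> insert t (R - {y}) \<and> N y \<inter> K t \<noteq> {} \<and> (\<forall>x\<in>K t - {t}. N x \<inter> K t \<noteq> {}))"
proof -
  have "finite R" using finite_subset[OF R(1) fin] .
  moreover have "finite (N x)" if "x \<in> R" for x using finite_subset[OF R(2)[OF that] fin] .
  ultimately obtain N' where sub: "\<And>x. N' x \<subseteq> N x" and linked': "linked k y R N'"
    and unique: "\<And>x u v. x \<in> R - {y} \<Longrightarrow> u \<in> N' x \<Longrightarrow> v \<in> N' x \<Longrightarrow> u = v"
    using linked_thinning[OF linked] by metis
  let ?K = "reaching N' (R - {y})"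
  define T where "T = {t\<in>W - R. N' y \<inter> ?K t \<noteq> {}}"
  have "k \<le> card T"
    unfolding T_def using R sub by (intro card_fan_targets[OF fin _ _ y linked' unique]) blast+
  moreover have "disjoint_family_on ?K T"
    by (rule disjoint_family_on_mono[OF _ disjoint_reaching[OF unique]]) (auto simp: T_def)
  moreover have
    "t \<in> ?K t \<and> ?K t \<subseteq> insert t (R - {y}) \<and> N y \<inter> ?K t \<noteq> {} \<and> (\<forall>x\<in>?K t - {t}. N x \<inter> ?K t \<noteq> {})"
    if "t \<in> T" for t
  proof (intro conjI ballI)
    show "t \<in> ?K t" by (rule reaching_self)
    show "?K t \<subseteq> insert t (R - {y})" using reaching_step(1)[of _ N' "R - {y}" t] by blast
    show "N y \<inter> ?K t \<noteq> {}" using that sub[of y] by (auto simp: T_def)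
    show "N x \<inter> ?K t \<noteq> {}" if "x \<in> ?K t - {t}" for x
      using reaching_step(2)[of x N' "R - {y}" t] that sub[of x] by blast
  qed
  moreover have "T \<subseteq> W - R" by (auto simp: T_def)
  ultimately show ?thesis by blast
qed

definition separates :: "('v \<Rightarrow> 'v set) \<Rightarrow> 'v \<Rightarrow> 'v \<Rightarrow> 'v set \<Rightarrow> bool" where
  "separates N s y X \<longleftrightarrow> y \<in> X \<and> (\<forall>x\<in>X. N x \<subseteq> insert s X - {y})"

lemma linked_if_not_separated:
  assumes fin: "finite W" and N: "\<And>x. x \<in> W \<Longrightarrow> N x \<subseteq> W"
    and no_separator: "\<And>X s. X \<subseteq> W \<Longrightarrow> \<not> separates N s y X"
  shows "linked 2 y {x\<in>W. y \<notin> N x} N"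
  unfolding linked_def
proof (intro allI impI)
  fix X assume X: "y \<in> X" "X \<subseteq> {x\<in>W. y \<notin> N x}"
  have "out_boundary N X \<subseteq> W" using X N by (auto simp: out_boundary_def)
  then have "finite (out_boundary N X)" using fin finite_subset by blast
  moreover have "\<not> out_boundary N X \<subseteq> {s}" for s
    using no_separator[of X s] X by (auto simp: separates_def out_boundary_def)
  ultimately show "2 \<le> card (out_boundary N X)" by (simp add: two_le_card_iff_not_subset_singleton)
qed

lemma two_sinkless_sets_meeting_in_point:
  assumes fin: "finite W" and N: "\<And>x. x \<in> W \<Longrightarrow> N x \<subseteq> W" and y: "y \<in> W" "y \<notin> N y"
    and no_separator: "\<And>X s. X \<subseteq> W \<Longrightarrow> \<not> separates N s y X"
  shows "\<exists>K L. K \<subseteq> W \<and> L \<subseteq> W \<and> K \<inter> L = {y} \<and> sinkless N K \<and> sinkless N L"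
proof -
  let ?R = "{x\<in>W. y \<notin> N x}"
  have linked: "linked 2 y ?R N" by (rule linked_if_not_separated[OF fin N no_separator])
  have "?R \<subseteq> W" "\<And>x. x \<in> ?R \<Longrightarrow> N x \<subseteq> W" "y \<in> ?R" using N y by auto
  from menger_fan[OF fin this linked]
  obtain T K where T: "T \<subseteq> W - ?R" "2 \<le> card T" "disjoint_family_on K T"
    and K: "\<And>t. t \<in> T \<Longrightarrow> t \<in> K t \<and> K t \<subseteq> insert t (?R - {y}) \<and> N y \<inter> K t \<noteq> {} \<and>
      (\<forall>x\<in>K t - {t}. N x \<inter> K t \<noteq> {})"
    by blast
  obtain B where "B \<subseteq> T" "card B = 2" using T(2) by (rule obtain_subset_with_card_n)
  then obtain s t where st: "s \<in> T" "t \<in> T" "s \<noteq> t" by (auto simp: card_2_iff)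
  have "sinkless N (insert y (K t))" if "t \<in> T" for t
    unfolding sinkless_def
  proof
    fix x assume "x \<in> insert y (K t)"
    then consider "x = y" | "x = t" | "x \<in> K t - {t}" by blast
    then show "N x \<inter> insert y (K t) \<noteq> {}"
    proof cases
      case 2
      then have "y \<in> N x" using that T(1) by blast
      then show ?thesis by blast
    qed (use K[OF that] in blast)+
  qed
  moreover have "insert y (K t) \<subseteq> W" if "t \<in> T" for t
    using K[OF that] T(1) that y(1) by blast
  moreover have "insert y (K s) \<inter> insert y (K t) = {y}"
    using disjoint_family_onD[OF T(3) st] by auto
  ultimately show ?thesis
    using st by (intro exI[of _ "insert y (K s)"] exI[of _ "insert y (K t)"]) simp
qed

definition redirect :: "'v \<Rightarrow> 'v \<Rightarrow> ('v \<Rightarrow> 'v set) \<Rightarrow> 'v \<Rightarrow> 'v set" where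
  "redirect s z N x = (if s \<in> N x then insert z (N x - {s}) else N x)"

locale minimal_closed_digraph =
  fixes N :: "'v \<Rightarrow> 'v set" and U :: "'v set"
  assumes finite_U: "finite U" and U_nonempty: "U \<noteq> {}"
    and closed: "x \<in> U \<Longrightarrow> N x \<subseteq> U - {x}"
    and minimal: "X \<subseteq> U \<Longrightarrow> X \<noteq> {} \<Longrightarrow> \<forall>x\<in>X. N x \<subseteq> X \<Longrightarrow> X = U"
    and outdegree: "x \<in> U \<Longrightarrow> 2 \<le> card (N x)"
begin

lemma another_out_neighbour:
  assumes "x \<in> U"
  shows "\<exists>u\<in>N x. u \<noteq> a"
proof -
  have "finite (N x)" using closed[OF assms] finite_U finite_subset by blast
  then have "\<not> N x \<subseteq> {a}"
    using outdegree[OF assms] by (simp add: two_le_card_iff_not_subset_singleton)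
  then show ?thesis by blast
qed

lemma separator_outside:
  assumes "X \<subseteq> U" "separates N s y X"
  shows "s \<in> U - X"
proof (rule ccontr)
  assume "s \<notin> U - X"
  then have "\<forall>x\<in>X. N x \<subseteq> X" using assms closed unfolding separates_def by blast
  then have "X = U" using assms by (intro minimal) (auto simp: separates_def)
  then have "\<forall>x\<in>U - {y}. N x \<subseteq> U - {y}" using assms closed by (auto simp: separates_def)
  moreover have "y \<in> U" using assms by (auto simp: separates_def)
  moreover from this have "U - {y} \<noteq> {}" using another_out_neighbour[of y y] closed[of y] by blast
  ultimately have "U - {y} = U" by (intro minimal) auto
  then show False using \<open>y \<in> U\<close> by blast
qed

lemma returning_set:
  assumes W: "W \<subseteq> U" and sep: "separates N s z W"
  shows "\<exists>Q\<subseteq>U - W. s \<in> Q \<and> (\<forall>q\<in>Q. N q \<inter> insert z Q \<noteq> {})"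
proof -
  define Q where "Q = reaching N (U - W) z - {z}"
  have z: "z \<in> W" and WN: "\<And>x. x \<in> W \<Longrightarrow> N x \<subseteq> insert s W - {z}"
    using sep by (auto simp: separates_def)
  have QU: "Q \<subseteq> U - W" using reaching_step(1)[of _ N "U - W" z] by (auto simp: Q_def)
  have "s \<in> Q"
  proof (rule ccontr)
    assume s: "s \<notin> Q"
    let ?C = "U - insert z Q"
    have "N x \<subseteq> ?C" if x: "x \<in> ?C" for x
    proof (cases "x \<in> W")
      case True
      then show ?thesis using WN[OF True] s QU closed x by blast
    next
      case False
      have "x \<notin> reaching N (U - W) z" using x by (auto simp: Q_def)
      then have "N x \<inter> reaching N (U - W) z = {}"
        using reaching_back[of x "U - W" _ N z] x False by blast
      then show ?thesis using closed[of x] x reaching_self[of z N] by (auto simp: Q_def)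
    qed
    moreover have "s \<in> ?C" using s separator_outside[OF W sep] z by auto
    ultimately have "?C = U" by (intro minimal) auto
    then show False using z W by auto
  qed
  moreover have "N q \<inter> insert z Q \<noteq> {}" if "q \<in> Q" for q
    using reaching_step(2)[of q N "U - W" z] that by (auto simp: Q_def)
  ultimately show ?thesis using QU by blast
qed

lemma sinkless_Un_returning_set:
  assumes K: "K \<subseteq> W" "sinkless (redirect s z N) K" and "s \<notin> W"
    and Q: "s \<in> Q" "\<forall>q\<in>Q. N q \<inter> insert z Q \<noteq> {}"
  shows "sinkless N (if z \<in> K then K \<union> Q else K)"
  unfolding sinkless_def
proof
  fix x assume x: "x \<in> (if z \<in> K then K \<union> Q else K)"
  show "N x \<inter> (if z \<in> K then K \<union> Q else K) \<noteq> {}"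
  proof (cases "x \<in> K")
    case True
    then obtain u where "u \<in> redirect s z N x" "u \<in> K" using K(2) by (auto simp: sinkless_def)
    then show ?thesis using Q(1) by (auto simp: redirect_def split: if_splits)
  next
    case False
    then show ?thesis using x Q(2) by (auto split: if_splits)
  qed
qed

text \<open>A separating set would avoid the in-neighbour \<open>z\<close> of \<open>y\<close>, contradicting the minimality of \<open>W\<close>.\<close>

lemma no_separator_after_redirection:
  assumes W: "W \<subseteq> U" "separates N s z W"
    and least: "\<And>s' y' X. X \<subseteq> U \<Longrightarrow> separates N s' y' X \<Longrightarrow> card W \<le> card X"
    and y: "y \<in> N z" "y \<noteq> s" and X: "X \<subseteq> W"
  shows "\<not> separates (redirect s z N) s' y X"
proof
  assume sep: "separates (redirect s z N) s' y X"
  have z: "z \<in> W" and WN: "\<And>x. x \<in> W \<Longrightarrow> N x \<subseteq> insert s W - {z}"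
    using W(2) by (auto simp: separates_def)
  have "y \<in> redirect s z N z" using y by (simp add: redirect_def)
  then have zX: "z \<notin> X" using sep by (auto simp: separates_def)
  have "separates N (if s' = z then s else s') y X"
    using sep y X zX WN unfolding separates_def redirect_def by (auto split: if_splits) blast+
  then have "card W \<le> card X" using X W(1) by (intro least) auto
  then have "X = W" by (rule card_seteq[OF finite_subset[OF W(1) finite_U] X])
  then show False using z zX by blast
qed

text \<open>If some vertex is separated from itself, take a smallest separating set \<open>W\<close>, say for \<open>s\<close> and \<open>z\<close>.
  The arcs from \<open>W\<close> to \<open>s\<close> are redirected to \<open>z\<close> to find two sets meeting in an out-neighbour of \<open>z\<close>;
  at most one of them contains \<open>z\<close> and has to be extended by a way back from \<open>s\<close> to \<open>z\<close> outside \<open>W\<close>.\<close>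

lemma sinkless_sets_meeting_in_point:
  "\<exists>K L y. K \<subseteq> U \<and> L \<subseteq> U \<and> K \<inter> L = {y} \<and> sinkless N K \<and> sinkless N L"
proof (cases "\<exists>X. X \<subseteq> U \<and> (\<exists>s y. separates N s y X)")
  case False
  obtain y where y: "y \<in> U" using U_nonempty by blast
  have "\<exists>K L. K \<subseteq> U \<and> L \<subseteq> U \<and> K \<inter> L = {y} \<and> sinkless N K \<and> sinkless N L"
    by (rule two_sinkless_sets_meeting_in_point[OF finite_U _ y]) (use closed y False in auto)
  then show ?thesis by metis
next
  case True
  define separating where "separating X \<longleftrightarrow> X \<subseteq> U \<and> (\<exists>s y. separates N s y X)" for X
  obtain X\<^sub>0 where "separating X\<^sub>0" using True by (auto simp: separating_def)
  then obtain W where "separating W" and "\<And>X. separating X \<Longrightarrow> card W \<le> card X"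
    using ex_has_least_nat[of separating X\<^sub>0 card] by blast
  then obtain s z where W: "W \<subseteq> U" "separates N s z W"
    and least: "\<And>s' y' X. X \<subseteq> U \<Longrightarrow> separates N s' y' X \<Longrightarrow> card W \<le> card X"
    unfolding separating_def by blast
  have z: "z \<in> W" and WN: "\<And>x. x \<in> W \<Longrightarrow> N x \<subseteq> insert s W - {z}"
    using W(2) by (auto simp: separates_def)
  obtain y where y: "y \<in> N z" "y \<noteq> s" using another_out_neighbour[of z s] z W by blast
  then have yW: "y \<in> W" "y \<noteq> z" using WN[OF z] by auto
  obtain Q where Q: "Q \<subseteq> U - W" "s \<in> Q" "\<forall>q\<in>Q. N q \<inter> insert z Q \<noteq> {}"
    using returning_set[OF W] by blast
  let ?N = "redirect s z N"
  have "finite W" using W(1) finite_U finite_subset by blast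
  moreover have "?N x \<subseteq> W" if "x \<in> W" for x using WN[OF that] z by (auto simp: redirect_def)
  moreover have "y \<notin> ?N y" using closed[of y] yW W(1) by (auto simp: redirect_def)
  moreover have "\<not> separates ?N s' y X" if "X \<subseteq> W" for s' X
    by (rule no_separator_after_redirection[OF W _ y that]) (rule least)
  ultimately obtain K L where KL: "K \<subseteq> W" "L \<subseteq> W" "K \<inter> L = {y}" "sinkless ?N K" "sinkless ?N L"
    using two_sinkless_sets_meeting_in_point[of W ?N y] yW(1) by metis
  let ?extend = "\<lambda>K. if z \<in> K then K \<union> Q else K"
  have "s \<notin> W" using separator_outside[OF W] by blast
  then have "sinkless N (?extend K)" "sinkless N (?extend L)"
    using sinkless_Un_returning_set KL Q by blast+
  moreover have "?extend K \<inter> ?extend L = {y}" using KL Q(1) yW by auto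
  moreover have "?extend K \<subseteq> U" "?extend L \<subseteq> U" using KL Q(1) W(1) by auto
  ultimately show ?thesis by blast
qed

end

text \<open>Thomassen's theorem on two directed cycles with exactly one common vertex: a finite nonempty
  sinkless set contains a directed cycle.\<close>

theorem thomassen_sinkless_sets_meeting_in_point:
  fixes N :: "'v \<Rightarrow> 'v set"
  assumes fin: "finite V" and "V \<noteq> {}" and N: "\<And>x. x \<in> V \<Longrightarrow> N x \<subseteq> V - {x}"
    and outdegree: "\<And>x. x \<in> V \<Longrightarrow> 2 \<le> card (N x)"
  shows "\<exists>K L y. K \<subseteq> V \<and> L \<subseteq> V \<and> K \<inter> L = {y} \<and> sinkless N K \<and> sinkless N L"
proof -
  define closed where "closed U \<longleftrightarrow> U \<subseteq> V \<and> U \<noteq> {} \<and> (\<forall>x\<in>U. N x \<subseteq> U)" for U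
  have "closed V" using assms by (auto simp: closed_def)
  then obtain U where U: "closed U" and least: "\<And>X. closed X \<Longrightarrow> card U \<le> card X"
    using ex_has_least_nat[of closed V card] by blast
  have finU: "finite U" using U fin by (auto simp: closed_def intro: finite_subset)
  interpret minimal_closed_digraph N U
  proof
    show "X = U" if "X \<subseteq> U" "X \<noteq> {}" "\<forall>x\<in>X. N x \<subseteq> X" for X
      using least[of X] that U card_seteq[OF finU that(1)] by (auto simp: closed_def)
  qed (use U finU N outdegree in \<open>auto simp: closed_def subset_iff\<close>)
  obtain K L y where "K \<subseteq> U" "L \<subseteq> U" "K \<inter> L = {y}" "sinkless N K" "sinkless N L"
    using sinkless_sets_meeting_in_point by metis
  moreover have "U \<subseteq> V" using U by (simp add: closed_def)
  ultimately show ?thesis by (metis subset_trans)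
qed

section \<open>The cycle space\<close>

definition is_edge :: "'v set \<Rightarrow> bool" where
  "is_edge p \<longleftrightarrow> (\<exists>a b. p = {a, b})"

definition cut :: "('e \<Rightarrow> 'v set) \<Rightarrow> 'v set \<Rightarrow> 'e set" where
  "cut en X = {e. en e \<inter> X \<noteq> {} \<and> \<not> en e \<subseteq> X}"

text \<open>Loops do not count.\<close>

definition degree :: "('e \<Rightarrow> 'v set) \<Rightarrow> 'e set \<Rightarrow> 'v \<Rightarrow> nat" where
  "degree en T v = card (T \<inter> cut en {v})"

definition even_set :: "('e \<Rightarrow> 'v set) \<Rightarrow> 'e set \<Rightarrow> bool" where
  "even_set en T \<longleftrightarrow> finite T \<and> (\<forall>v. even (degree en T v))"

lemma card_add_card_sym_diff:
  assumes "finite A" "finite B"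
  shows "card A + card B + card (sym_diff A B) = 2 * card (A \<union> B)"
proof -
  have "card A = card (A - B) + card (A \<inter> B)" "card B = card (B - A) + card (A \<inter> B)"
    using assms by (metis card_Int_Diff add.commute Int_commute)+
  moreover have "card (sym_diff A B) = card (A - B) + card (B - A)"
    using assms by (intro card_Un_disjoint) auto
  ultimately show ?thesis using card_Un_Int[OF assms] by linarith
qed

lemma card_sym_diff_add_card:
  assumes "finite X" "h \<notin> X" "h \<in> T" "T \<subseteq> insert h X"
  shows "card (sym_diff X T) + card T = card X + 2"
proof -
  have "finite T" using assms(1,4) finite_subset by blast
  moreover have "X \<union> T = insert h X" using assms(3,4) by blast
  ultimately show ?thesis using card_add_card_sym_diff[of X T] assms(1,2) by simp
qed

lemma even_card_sym_diff:
  assumes "finite A" "finite B"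
  shows "even (card (sym_diff A B)) \<longleftrightarrow> (even (card A) \<longleftrightarrow> even (card B))"
  using card_add_card_sym_diff[OF assms] by presburger

lemma even_degree_sym_diff:
  assumes "finite A" "finite B"
  shows "even (degree en (sym_diff A B) v) \<longleftrightarrow> (even (degree en A v) \<longleftrightarrow> even (degree en B v))"
proof -
  have "sym_diff A B \<inter> cut en {v} = sym_diff (A \<inter> cut en {v}) (B \<inter> cut en {v})" by auto
  then show ?thesis using assms by (simp add: degree_def even_card_sym_diff)
qed

lemma even_set_sym_diff:
  assumes "even_set en A" "even_set en B"
  shows "even_set en (sym_diff A B)"
  using assms by (auto simp: even_set_def even_degree_sym_diff)

lemma cut_insert_iff:
  assumes "is_edge (en e)" "v \<notin> X"
  shows "e \<in> cut en (insert v X) \<longleftrightarrow> (e \<in> cut en X \<longleftrightarrow> e \<notin> cut en {v})"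
  using assms by (auto simp: is_edge_def cut_def)

lemma even_card_cut_iff:
  assumes "finite T" "finite X" "\<And>e. e \<in> T \<Longrightarrow> is_edge (en e)"
  shows "even (card (T \<inter> cut en X)) \<longleftrightarrow> even (\<Sum>v\<in>X. degree en T v)"
  using assms(2)
proof (induction X)
  case empty
  then show ?case by (simp add: cut_def)
next
  case (insert v X)
  have "T \<inter> cut en (insert v X) = sym_diff (T \<inter> cut en X) (T \<inter> cut en {v})"
    using cut_insert_iff[where en=en, of _ v X] assms(3) insert(2) by auto
  then show ?case using assms(1) insert by (simp add: even_card_sym_diff degree_def) blast
qed

lemma even_card_Int_cut:
  assumes "even_set en T" "finite X" "\<And>e. e \<in> T \<Longrightarrow> is_edge (en e)"
  shows "even (card (T \<inter> cut en X))"
  using even_card_cut_iff[of T X en] assms by (simp add: even_set_def dvd_sum)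

lemma even_degree_if_other_degrees_even:
  assumes "finite T" "finite X" "\<And>e. e \<in> T \<Longrightarrow> is_edge (en e)" and "even (card (T \<inter> cut en X))"
    and "w \<in> X" "\<And>v. v \<in> X - {w} \<Longrightarrow> even (degree en T v)"
  shows "even (degree en T w)"
proof -
  have "(\<Sum>v\<in>X. degree en T v) = degree en T w + (\<Sum>v\<in>X - {w}. degree en T v)"
    using assms(2,5) by (rule sum.remove)
  moreover have "even (\<Sum>v\<in>X - {w}. degree en T v)" using assms(6) by (rule dvd_sum)
  ultimately show ?thesis using even_card_cut_iff[of T X en] assms(1-4) by simp
qed

text \<open>There are more subsets of \<open>S\<close> than sets of odd-degree vertices avoiding a fixed vertex.\<close>

lemma exists_even_subset:
  assumes fin: "finite S" "finite W" and ends: "\<And>e. e \<in> S \<Longrightarrow> is_edge (en e) \<and> en e \<subseteq> W"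
    and card: "card W \<le> card S" "S \<noteq> {}"
  shows "\<exists>T\<subseteq>S. T \<noteq> {} \<and> even_set en T"
proof -
  obtain w where w: "w \<in> W" using ends card(2) by (fastforce simp: is_edge_def)
  define odd_vertices where "odd_vertices T = {v\<in>W - {w}. odd (degree en T v)}" for T
  have "card (Pow (W - {w})) < card (Pow S)"
    using fin w card card_gt_0_iff[of W] by (auto simp: card_Pow)
  moreover have "odd_vertices ` Pow S \<subseteq> Pow (W - {w})" by (auto simp: odd_vertices_def)
  ultimately have "\<not> inj_on odd_vertices (Pow S)"
    using fin card_inj_on_le[of odd_vertices "Pow S" "Pow (W - {w})"] by auto
  then obtain A B where AB: "A \<subseteq> S" "B \<subseteq> S" "A \<noteq> B" "odd_vertices A = odd_vertices B"
    by (auto simp: inj_on_def)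
  define T where "T = sym_diff A B"
  have T: "T \<subseteq> S" "T \<noteq> {}" using AB by (auto simp: T_def)
  have finAB: "finite A" "finite B" "finite T"
    using AB(1,2)[THEN finite_subset] T(1)[THEN finite_subset] fin(1) by simp_all
  have others: "even (degree en T v)" if "v \<in> W - {w}" for v
    using AB(4) that finAB by (auto simp: T_def even_degree_sym_diff odd_vertices_def set_eq_iff)
  have edges: "is_edge (en e)" if "e \<in> T" for e using ends that T(1) by blast
  have "T \<inter> cut en W = {}" using ends T by (auto simp: cut_def)
  then have cut_even: "even (card (T \<inter> cut en W))" by simp
  have "even (degree en T w)"
    by (rule even_degree_if_other_degrees_even[OF finAB(3) fin(2) edges cut_even w others])
  moreover have "degree en T v = 0" if "v \<notin> W" for v
  proof -
    have "T \<inter> cut en {v} = {}" using ends T that by (auto simp: cut_def)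
    then show ?thesis by (simp add: degree_def)
  qed
  ultimately have "even (degree en T v)" for v using others by (cases "v = w"; cases "v \<in> W") auto
  then show ?thesis using T finAB by (auto simp: even_set_def)
qed

text \<open>The cycle space of \<open>S\<close> has dimension at least two.\<close>

definition bicyclic :: "('e \<Rightarrow> 'v set) \<Rightarrow> 'e set \<Rightarrow> bool" where
  "bicyclic en S \<longleftrightarrow> (\<exists>X Y. X \<subseteq> S \<and> Y \<subseteq> S \<and> X \<noteq> {} \<and> Y \<noteq> {} \<and> X \<noteq> Y \<and> even_set en X \<and> even_set en Y)"

lemma bicyclic_if_card_less:
  assumes fin: "finite S" "finite W" and ends: "\<And>e. e \<in> S \<Longrightarrow> is_edge (en e) \<and> en e \<subseteq> W"
    and card: "card W < card S"
  shows "bicyclic en S"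
proof -
  have "\<exists>X\<subseteq>S. X \<noteq> {} \<and> even_set en X"
    by (rule exists_even_subset[OF fin]) (use ends card in force)+
  then obtain X where X: "X \<subseteq> S" "X \<noteq> {}" "even_set en X" by blast
  then obtain e where e: "e \<in> X" by blast
  have "card (S - {e}) = card S - 1" using e X by (simp add: subset_iff)
  moreover have "card W \<noteq> 0" using ends[of e] e X fin by (auto simp: is_edge_def)
  ultimately have "card W \<le> card (S - {e})" "card (S - {e}) \<noteq> 0" using card by linarith+
  moreover from this have "S - {e} \<noteq> {}" by (metis card.empty)
  ultimately have "\<exists>Y\<subseteq>S - {e}. Y \<noteq> {} \<and> even_set en Y"
    by (intro exists_even_subset[of _ W]) (use fin ends in auto)
  then obtain Y where Y: "Y \<subseteq> S - {e}" "Y \<noteq> {}" "even_set en Y" by blast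
  then show ?thesis using X e unfolding bicyclic_def by (intro exI[of _ X] exI[of _ Y]) auto
qed

section \<open>Cycles of multigraphs\<close>

lemma sum_cyclic_shift: "(\<Sum>i<k. f (Suc i mod k)) = (\<Sum>i<k. f i :: nat)"
proof (cases k)
  case (Suc n)
  have "(\<Sum>i<Suc n. f (Suc i mod Suc n)) = (\<Sum>i<n. f (Suc i)) + f 0" by simp
  also have "\<dots> = (\<Sum>i<Suc n. f i)" by (simp add: sum.lessThan_Suc_shift del: sum.lessThan_Suc)
  finally show ?thesis using Suc by simp
qed simp

lemma even_set_cycle_edges:
  assumes "cycle_edges G C"
  shows "C \<noteq> {}" "even_set (ends G) C"
proof -
  obtain vs es where es: "es \<noteq> []" "distinct es" "set es = C"
    and ends: "\<And>i. i < length es \<Longrightarrow> ends G (es ! i) = {vs ! i, vs ! (Suc i mod length es)}"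
    using assms by (auto simp: cycle_edges_def)
  show "C \<noteq> {}" using es by auto
  have "even (degree (ends G) C v)" for v
  proof -
    let ?k = "length es"
    define visits :: "nat \<Rightarrow> nat" where "visits i = of_bool (vs ! i = v)" for i
    have "C \<inter> cut (ends G) {v} = (!) es ` {i\<in>{..<?k}. es ! i \<in> cut (ends G) {v}}"
      using es(3) by (auto simp: in_set_conv_nth)
    moreover have "inj_on ((!) es) {i\<in>{..<?k}. es ! i \<in> cut (ends G) {v}}"
      using es(2) by (auto simp: inj_on_def nth_eq_iff_index_eq)
    moreover have "es ! i \<in> cut (ends G) {v} \<longleftrightarrow> odd (visits i + visits (Suc i mod ?k))"
      if "i < ?k" for i
      using ends[OF that] by (auto simp: cut_def visits_def)
    then have
      "{i\<in>{..<?k}. es ! i \<in> cut (ends G) {v}} = {i\<in>{..<?k}. odd (visits i + visits (Suc i mod ?k))}"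
      by blast
    ultimately have "degree (ends G) C v = card {i\<in>{..<?k}. odd (visits i + visits (Suc i mod ?k))}"
      by (simp add: degree_def card_image)
    moreover have "(\<Sum>i<?k. visits i + visits (Suc i mod ?k)) = 2 * (\<Sum>i<?k. visits i)"
      by (simp add: sum.distrib sum_cyclic_shift)
    ultimately show ?thesis
      using even_sum_iff[of "{..<?k}" "\<lambda>i. visits i + visits (Suc i mod ?k)"] by simp
  qed
  then show "even_set (ends G) C" using es(3) by (auto simp: even_set_def)
qed

definition path_edges :: "('v, 'e) pre_multigraph \<Rightarrow> 'v list \<Rightarrow> 'e list \<Rightarrow> bool" where
  "path_edges G vs es \<longleftrightarrow> length vs = Suc (length es) \<and> distinct vs \<and>
    (\<forall>i<length es. ends G (es ! i) = {vs ! i, vs ! Suc i})"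

lemma last_path_edges: "path_edges G vs es \<Longrightarrow> last vs = vs ! length es"
  by (cases vs rule: rev_cases) (auto simp: path_edges_def nth_append)

lemma path_edges_snoc:
  assumes "path_edges G vs es" "ends G e = {last vs, x}" "x \<notin> set vs"
  shows "path_edges G (vs @ [x]) (es @ [e])"
  using assms last_path_edges[OF assms(1)] by (auto simp: path_edges_def nth_append less_Suc_eq)

lemma path_edges_drop: "path_edges G vs es \<Longrightarrow> j \<le> length es \<Longrightarrow> path_edges G (drop j vs) (drop j es)"
  by (auto simp: path_edges_def add.commute)

lemma distinct_path_edges:
  assumes "path_edges G vs es"
  shows "distinct es"
proof -
  have "es ! i \<noteq> es ! j" if "i < length es" "j < length es" "i \<noteq> j" for i j
  proof -
    have "{vs ! i, vs ! Suc i} \<noteq> {vs ! j, vs ! Suc j}"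
      using that assms by (auto simp: path_edges_def doubleton_eq_iff nth_eq_iff_index_eq)
    then show ?thesis using assms that by (metis path_edges_def)
  qed
  then show ?thesis by (simp add: distinct_conv_nth)
qed

lemma last_notin_butlast_path_edge:
  assumes "path_edges G vs es" "e \<in> set es" "e \<noteq> last es"
  shows "last vs \<notin> ends G e"
proof -
  obtain i where i: "i < length es" "e = es ! i" using assms(2) by (auto simp: in_set_conv_nth)
  then have "i \<noteq> length es - 1" using assms(2,3) last_conv_nth[of es] by fastforce
  then show ?thesis
    using assms(1) i last_path_edges[OF assms(1)] by (auto simp: path_edges_def nth_eq_iff_index_eq)
qed

lemma cycle_edges_if_path_edges_closed:
  assumes path: "path_edges G vs es" and e: "ends G e = {last vs, hd vs}" "e \<notin> set es"
    and edges: "insert e (set es) \<subseteq> edges G"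
  shows "cycle_edges G (insert e (set es))"
  unfolding cycle_edges_def
proof (intro exI[of _ vs] exI[of _ "es @ [e]"] conjI allI impI)
  show "distinct (es @ [e])" using distinct_path_edges[OF path] e(2) by simp
  fix i assume i: "i < length (es @ [e])"
  show "ends G ((es @ [e]) ! i) = {vs ! i, vs ! (Suc i mod length (es @ [e]))}"
  proof (cases "i = length es")
    case True
    moreover have "vs \<noteq> []" using path by (auto simp: path_edges_def)
    ultimately show ?thesis using path e(1) by (auto simp: path_edges_def last_conv_nth hd_conv_nth)
  next
    case False
    then show ?thesis using i path by (auto simp: path_edges_def nth_append)
  qed
qed (use path edges in \<open>auto simp: path_edges_def\<close>)

lemma longest_path_in:
  assumes G: "multigraph G" and T: "T \<subseteq> edges G" and e: "e \<in> T" "card (ends G e) = 2"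
  shows "\<exists>vs es. path_edges G vs es \<and> set es \<subseteq> T \<and> es \<noteq> [] \<and>
    (\<forall>vs' es'. path_edges G vs' es' \<longrightarrow> set es' \<subseteq> T \<longrightarrow> length es' \<le> length es)"
proof -
  interpret multigraph G by (rule G)
  define path_length where
    "path_length k \<longleftrightarrow> (\<exists>vs es. path_edges G vs es \<and> set es \<subseteq> T \<and> length es = k)" for k
  obtain a b where "ends G e = {a, b}" "a \<noteq> b" using e(2) by (auto simp: card_2_iff)
  then have "path_edges G [a, b] [e]" by (simp add: path_edges_def)
  then have one: "path_length 1" using e(1) unfolding path_length_def
    by (intro exI[of _ "[a, b]"] exI[of _ "[e]"]) simp
  have bound: "\<forall>k. path_length k \<longrightarrow> k \<le> card (edges G)"
  proof (intro allI impI)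
    fix k assume "path_length k"
    then obtain vs es where "path_edges G vs es" "set es \<subseteq> T" "length es = k"
      by (auto simp: path_length_def)
    then have "card (set es) = k" "set es \<subseteq> edges G"
      using distinct_card[OF distinct_path_edges] T by blast+
    then show "k \<le> card (edges G)" using card_mono[OF finite_edges] by blast
  qed
  obtain k where k: "path_length k" "\<And>l. path_length l \<Longrightarrow> l \<le> k"
    using GreatestI_nat[of path_length, OF one] Greatest_le_nat[of path_length] bound by metis
  then obtain vs es where "path_edges G vs es" "set es \<subseteq> T" "length es = k"
    by (auto simp: path_length_def)
  moreover from this have "es \<noteq> []" using k(2)[OF one] by auto
  ultimately show ?thesis using k(2) unfolding path_length_def by blast
qed

lemma exists_cycle_edges_subset:
  assumes G: "multigraph G" and T: "T \<subseteq> edges G" "T \<noteq> {}" "even_set (ends G) T"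
  shows "\<exists>C\<subseteq>T. cycle_edges G C"
proof (cases "\<exists>e\<in>T. card (ends G e) = 1")
  case True
  then obtain e v where "e \<in> T" "ends G e = {v}" by (auto simp: card_1_singleton_iff)
  then have "cycle_edges G {e}" using T unfolding cycle_edges_def
    by (intro exI[of _ "[v]"] exI[of _ "[e]"]) auto
  then show ?thesis using \<open>e \<in> T\<close> by blast
next
  case False
  interpret multigraph G by (rule G)
  have two: "card (ends G e) = 2" if "e \<in> T" for e using False card_ends that T by blast
  obtain vs es where path: "path_edges G vs es" "set es \<subseteq> T" "es \<noteq> []"
    and longest: "\<And>vs' es'. path_edges G vs' es' \<Longrightarrow> set es' \<subseteq> T \<Longrightarrow> length es' \<le> length es"
    using longest_path_in[OF G T(1)] two T(2) by blast
  let ?u = "last vs"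
  have last_edge: "last es \<in> T" using path by auto
  have "?u \<in> ends G (last es)"
    using path(1,3) last_path_edges[OF path(1)] by (auto simp: path_edges_def last_conv_nth)
  then have "last es \<in> T \<inter> cut (ends G) {?u}"
    using two[OF last_edge] last_edge by (auto simp: cut_def card_2_iff)
  moreover have "T \<inter> cut (ends G) {?u} \<noteq> {last es}"
    using T(3) by (auto simp: even_set_def degree_def dest!: spec[of _ ?u])
  ultimately obtain e where e: "e \<in> T" "?u \<in> ends G e" "e \<noteq> last es" by (auto simp: cut_def)
  then obtain x where x: "ends G e = {?u, x}"
    using two[OF e(1)] by (auto simp: card_2_iff doubleton_eq_iff)
  have "x \<in> set vs"
    using path_edges_snoc[OF path(1) x] longest[of "vs @ [x]" "es @ [e]"] path(2) e(1) by auto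
  then obtain j where j: "j < length vs" "vs ! j = x" by (auto simp: in_set_conv_nth)
  then have "j \<le> length es" using path(1) by (simp add: path_edges_def)
  then have "path_edges G (drop j vs) (drop j es)" using path(1) by (rule path_edges_drop[rotated])
  moreover have "ends G e = {last (drop j vs), hd (drop j vs)}"
    using x j by (simp add: hd_drop_conv_nth)
  moreover have sub: "set (drop j es) \<subseteq> set es" by (rule set_drop_subset)
  moreover have "e \<notin> set es" using last_notin_butlast_path_edge[OF path(1)] e by blast
  ultimately have "cycle_edges G (insert e (set (drop j es)))"
    using path(2) e(1) T(1) by (intro cycle_edges_if_path_edges_closed) auto
  then show ?thesis using path(2) e(1) sub by (intro exI[of _ "insert e (set (drop j es))"]) auto
qed

section \<open>Matroids\<close>

context matroid
begin

lemma finite_indeps: "finite (indeps M)"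
  by (rule finite_subset[of _ "Pow (ground M)"]) (use finite_ground indep_subset_ground in blast)+

lemma card_indep_le_rank: "I \<in> indeps M \<Longrightarrow> card I \<le> matroid_rank M"
  unfolding matroid_rank_def rank_of_def
  using finite_indeps indep_subset_ground by (intro Max_ge) auto

lemma exists_indep_card_eq_rank: "\<exists>I\<in>indeps M. card I = matroid_rank M"
proof -
  have "card ` {I \<in> indeps M. I \<subseteq> ground M} \<noteq> {}" using indep_empty by auto
  then have "matroid_rank M \<in> card ` {I \<in> indeps M. I \<subseteq> ground M}"
    unfolding matroid_rank_def rank_of_def using finite_indeps by (intro Max_in) auto
  then show ?thesis by auto
qed

lemma card_basis:
  assumes "basis M B"
  shows "card B = matroid_rank M"
proof -
  obtain J where J: "J \<in> indeps M" "card J = matroid_rank M"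
    using exists_indep_card_eq_rank by blast
  have "\<not> card B < card J"
    using indep_augment[of B J] assms J by (auto simp: basis_def)
  then show ?thesis using card_indep_le_rank[of B] assms J by (simp add: basis_def)
qed

lemma basis_subset_ground: "basis M B \<Longrightarrow> B \<subseteq> ground M"
  using indep_subset_ground by (simp add: basis_def)

lemma indep_extends_to_basis:
  assumes "I \<in> indeps M"
  shows "\<exists>B. basis M B \<and> I \<subseteq> B"
proof -
  have "\<exists>B\<in>{B \<in> indeps M. I \<subseteq> B}. \<forall>J\<in>{B \<in> indeps M. I \<subseteq> B}. B \<subseteq> J \<longrightarrow> B = J"
    by (rule finite_has_maximal) (use finite_indeps assms in auto)
  then obtain B where B: "B \<in> indeps M" "I \<subseteq> B"
    and maximal: "\<forall>J\<in>{B \<in> indeps M. I \<subseteq> B}. B \<subseteq> J \<longrightarrow> B = J"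
    by blast
  have "J = B" if "J \<in> indeps M" "B \<subseteq> J" for J using maximal that B(2) by blast
  then have "basis M B" using B(1) by (simp add: basis_def)
  then show ?thesis using B(2) by blast
qed

lemma dependent_contains_circuit:
  assumes "D \<subseteq> ground M" "D \<notin> indeps M"
  shows "\<exists>C\<subseteq>D. circuit M C"
proof -
  let ?S = "{C. C \<subseteq> D \<and> C \<notin> indeps M}"
  have "finite D" using assms finite_ground finite_subset by blast
  then have "\<exists>C\<in>?S. \<forall>J\<in>?S. J \<subseteq> C \<longrightarrow> C = J"
    by (intro finite_has_minimal) (use assms in auto)
  then obtain C where "C \<in> ?S" "\<forall>J\<in>?S. J \<subseteq> C \<longrightarrow> C = J" by blast
  then have "C \<subseteq> D" "circuit M C" using assms(1) by (auto simp: circuit_def)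
  then show ?thesis by blast
qed

lemma simple_matroid_indep:
  assumes "simple_matroid M" "D \<subseteq> ground M" "card D \<le> 2"
  shows "D \<in> indeps M"
proof (rule ccontr)
  assume "D \<notin> indeps M"
  then obtain C where C: "C \<subseteq> D" "circuit M C" using dependent_contains_circuit assms by blast
  have "finite D" using assms finite_ground finite_subset by blast
  then have "card C \<le> 2" "finite C" using C assms card_mono[of D C] finite_subset by auto
  moreover have "C \<noteq> {}" using C indep_empty by (auto simp: circuit_def)
  ultimately have "card C = 1 \<or> card C = 2" using card_0_eq[of C] by linarith
  then show False
    using C assms
    by (auto simp: card_1_singleton_iff card_2_iff simple_matroid_def loop_def parallel_def)
qed

lemma basis_dual:
  assumes "basis M B"
  shows "basis (dual M) (ground M - B)"
  unfolding basis_def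
proof (intro conjI ballI impI)
  show "ground M - B \<in> indeps (dual M)" using assms by (auto simp: dual_def)
  fix I assume "I \<in> indeps (dual M)" and sub: "ground M - B \<subseteq> I"
  then obtain B' where B': "basis M B'" "I \<subseteq> ground M - B'" by (auto simp: dual_def)
  then have "B' \<subseteq> B" using sub basis_subset_ground by blast
  then have "B' = B" using assms B'(1) by (auto simp: basis_def)
  then show "I = ground M - B" using sub B'(2) by blast
qed

lemma indep_disjoint_dual_basis:
  assumes "I \<in> indeps M"
  shows "\<exists>B. basis (dual M) B \<and> B \<subseteq> ground M \<and> I \<inter> B = {}"
proof -
  obtain B where "basis M B" "I \<subseteq> B" using indep_extends_to_basis[OF assms] by blast
  then show ?thesis using basis_dual by (intro exI[of _ "ground M - B"]) auto
qed

end

section \<open>Matroids represented by graphs\<close>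

definition forest :: "('e \<Rightarrow> 'v set) \<Rightarrow> 'e set \<Rightarrow> bool" where
  "forest en I \<longleftrightarrow> (\<forall>T\<subseteq>I. even_set en T \<longrightarrow> T = {})"

definition represents :: "'a pre_matroid \<Rightarrow> 'v set \<Rightarrow> ('a \<Rightarrow> 'v set) \<Rightarrow> bool" where
  "represents M V en \<longleftrightarrow> finite V \<and> V \<noteq> {} \<and> (\<forall>e\<in>ground M. is_edge (en e) \<and> en e \<subseteq> V) \<and>
    (\<forall>I. I \<subseteq> ground M \<longrightarrow> (I \<in> indeps M \<longleftrightarrow> forest en I))"

definition connected_edges :: "'v set \<Rightarrow> 'e set \<Rightarrow> ('e \<Rightarrow> 'v set) \<Rightarrow> bool" where
  "connected_edges V E en \<longleftrightarrow> (\<forall>X\<subseteq>V. X \<noteq> {} \<longrightarrow> X \<noteq> V \<longrightarrow> E \<inter> cut en X \<noteq> {})"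

lemma even_set_image_iff:
  assumes "inj_on f T" "\<And>e. e \<in> T \<Longrightarrow> en' (f e) = en e"
  shows "even_set en' (f ` T) \<longleftrightarrow> even_set en T"
proof -
  have "f e \<in> cut en' {v} \<longleftrightarrow> e \<in> cut en {v}" if "e \<in> T" for e v
    using assms(2)[OF that] by (simp add: cut_def)
  then have "f ` T \<inter> cut en' {v} = f ` (T \<inter> cut en {v})" for v by blast
  moreover have "inj_on f (T \<inter> cut en {v})" for v using assms(1) by (rule inj_on_subset) auto
  ultimately have "degree en' (f ` T) v = degree en T v" for v by (simp add: degree_def card_image)
  then show ?thesis using assms(1) by (simp add: even_set_def finite_image_iff)
qed

lemma forest_image_iff:
  assumes "inj_on f I" "\<And>e. e \<in> I \<Longrightarrow> en' (f e) = en e"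
  shows "forest en' (f ` I) \<longleftrightarrow> forest en I"
proof -
  have "even_set en' (f ` T) \<longleftrightarrow> even_set en T" if "T \<subseteq> I" for T
    using that assms by (intro even_set_image_iff) (auto intro: inj_on_subset)
  then show ?thesis unfolding forest_def all_subset_image by (simp cong: imp_cong)
qed

lemma indep_cycle_matroid_iff:
  assumes "multigraph G" "I \<subseteq> edges G"
  shows "I \<in> indeps (cycle_matroid G) \<longleftrightarrow> forest (ends G) I"
proof -
  have "(\<exists>C. cycle_edges G C \<and> C \<subseteq> I) \<longleftrightarrow> \<not> forest (ends G) I"
    using even_set_cycle_edges[of G] exists_cycle_edges_subset[OF assms(1)] assms(2)
    unfolding forest_def by (meson subset_trans)
  then show ?thesis using assms(2) by (auto simp: cycle_matroid_def)
qed

lemma graphic_represents: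
  assumes "graphic M"
  shows "\<exists>(V :: nat set) en. represents M V en"
proof -
  obtain G :: "(nat, nat) pre_multigraph" and f where G: "multigraph G"
    and f: "bij_betw f (ground M) (edges G)"
    and indep: "\<And>I. I \<subseteq> ground M \<Longrightarrow> I \<in> indeps M \<longleftrightarrow> f ` I \<in> indeps (cycle_matroid G)"
    using assms by (auto simp: graphic_def isomorphic_def cycle_matroid_def)
  interpret multigraph G by (rule G)
  have "represents M (insert 0 (vertices G)) (ends G \<circ> f)"
    unfolding represents_def
  proof (intro conjI ballI allI impI)
    fix e assume "e \<in> ground M"
    then have "f e \<in> edges G" using f by (auto simp: bij_betw_def)
    then show "is_edge ((ends G \<circ> f) e)" "(ends G \<circ> f) e \<subseteq> insert 0 (vertices G)"
      using card_ends[of "f e"] ends_subset[of "f e"]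
      by (auto simp: is_edge_def card_1_singleton_iff card_2_iff)
  next
    fix I assume I: "I \<subseteq> ground M"
    then have "f ` I \<subseteq> edges G" "inj_on f I"
      using f by (auto simp: bij_betw_def intro: inj_on_subset)
    then show "I \<in> indeps M \<longleftrightarrow> forest (ends G \<circ> f) I"
      using indep[OF I] indep_cycle_matroid_iff[OF G] forest_image_iff[of f I "ends G" "ends G \<circ> f"]
      by simp
  qed (use finite_vertices in auto)
  then show ?thesis by blast
qed

definition identify :: "'v \<Rightarrow> 'v \<Rightarrow> ('e \<Rightarrow> 'v set) \<Rightarrow> 'e \<Rightarrow> 'v set" where
  "identify x y en e = (\<lambda>v. if v = y then x else v) ` en e"

lemma cut_identify:
  assumes "x \<noteq> y"
  shows "cut (identify x y en) {x} = cut en {x, y}" "cut (identify x y en) {y} = {}"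
    and "v \<noteq> x \<Longrightarrow> v \<noteq> y \<Longrightarrow> cut (identify x y en) {v} = cut en {v}"
  using assms by (auto simp: cut_def identify_def split: if_splits)

lemma even_set_identify_iff:
  assumes T: "finite T" "\<And>e. e \<in> T \<Longrightarrow> is_edge (en e)"
    and X: "finite X" "x \<in> X" "y \<notin> X" "T \<inter> cut en X = {}"
  shows "even_set (identify x y en) T \<longleftrightarrow> even_set en T"
proof -
  have "x \<noteq> y" using X by auto
  note cuts = cut_identify[OF this, where en = en]
  show ?thesis
  proof
    assume even: "even_set en T"
    have "even (degree (identify x y en) T v)" for v
      using even even_card_Int_cut[OF even _ T(2), of "{x, y}"] cuts
      by (cases "v = x"; cases "v = y") (auto simp: even_set_def degree_def)
    then show "even_set (identify x y en) T" using T(1) by (simp add: even_set_def)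
  next
    assume even: "even_set (identify x y en) T"
    have others: "even (degree en T v)" if "v \<noteq> x" "v \<noteq> y" for v
      using even by (simp add: even_set_def degree_def flip: cuts(3)[OF that])
    have deg_x: "even (degree en T x)"
      by (rule even_degree_if_other_degrees_even[of T X]) (use T X others in auto)
    have "even (card (T \<inter> cut en {x, y}))"
      using even cuts(1) by (metis even_set_def degree_def)
    then have "even (degree en T y)"
      by (rule even_degree_if_other_degrees_even[of T "{x, y}", rotated 3]) (use T deg_x in auto)
    then have "even (degree en T v)" for v using deg_x others by (cases "v = x"; cases "v = y") auto
    then show "even_set en T" using T(1) by (simp add: even_set_def)
  qed
qed

lemma represents_identify:
  assumes rep: "represents M V en" and fin: "finite (ground M)"
    and X: "X \<subseteq> V" "ground M \<inter> cut en X = {}" and x: "x \<in> X" and y: "y \<in> V - X"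
  shows "represents M (V - {y}) (identify x y en)"
proof -
  have finV: "finite V" and edge: "\<And>e. e \<in> ground M \<Longrightarrow> is_edge (en e) \<and> en e \<subseteq> V"
    and indep: "\<And>I. I \<subseteq> ground M \<Longrightarrow> I \<in> indeps M \<longleftrightarrow> forest en I"
    using rep by (auto simp: represents_def)
  have finX: "finite X" using X(1) finV by (rule finite_subset)
  have even_iff: "even_set (identify x y en) T \<longleftrightarrow> even_set en T" if "T \<subseteq> ground M" for T
    by (rule even_set_identify_iff[of T en X])
      (use that fin finX edge x y X in \<open>auto intro: finite_subset\<close>)
  show ?thesis
    unfolding represents_def
  proof (intro conjI ballI allI impI)
    show "V - {y} \<noteq> {}" using x X(1) y by auto
    fix e assume "e \<in> ground M"
    then obtain a b where "en e = {a, b}" "{a, b} \<subseteq> V" using edge[of e] by (auto simp: is_edge_def)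
    moreover from this have "identify x y en e = {if a = y then x else a, if b = y then x else b}"
      by (auto simp: identify_def)
    ultimately show "is_edge (identify x y en e)" "identify x y en e \<subseteq> V - {y}"
      using x y X(1) by (auto simp: is_edge_def)
  next
    fix I assume "I \<subseteq> ground M"
    then show "I \<in> indeps M \<longleftrightarrow> forest (identify x y en) I"
      using indep even_iff unfolding forest_def by (meson subset_trans)
  qed (use finV in auto)
qed

lemma connected_representation:
  assumes "graphic M" "finite (ground M)"
  shows "\<exists>(V :: nat set) en. represents M V en \<and> connected_edges V (ground M) en"
proof -
  define representable where "representable V \<longleftrightarrow> (\<exists>en. represents M V en)" for V :: "nat set"
  obtain V\<^sub>0 where "representable V\<^sub>0"
    using graphic_represents[OF assms(1)] by (auto simp: representable_def)
  then obtain V where V: "representable V" and least: "\<And>V'. representable V' \<Longrightarrow> card V \<le> card V'"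
    using ex_has_least_nat[of representable V\<^sub>0 card] by blast
  obtain en where en: "represents M V en" using V by (auto simp: representable_def)
  have "ground M \<inter> cut en X \<noteq> {}" if X: "X \<subseteq> V" "X \<noteq> {}" "X \<noteq> V" for X
  proof
    assume disconnected: "ground M \<inter> cut en X = {}"
    obtain x y where x: "x \<in> X" and y: "y \<in> V - X" using X by blast
    have "representable (V - {y})"
      using represents_identify[OF en assms(2) X(1) disconnected x y]
      by (auto simp: representable_def)
    then have "card V \<le> card (V - {y})" by (rule least)
    moreover have "card (V - {y}) < card V"
      using en y by (intro card_Diff1_less) (auto simp: represents_def)
    ultimately show False by linarith
  qed
  then show ?thesis using en unfolding connected_edges_def by blast
qed

lemma cut_meets_basis:
  assumes rep: "represents M V en" and B: "basis M B" "B \<subseteq> ground M"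
    and X: "X \<subseteq> V" "ground M \<inter> cut en X \<noteq> {}"
  shows "B \<inter> cut en X \<noteq> {}"
proof
  assume disjoint: "B \<inter> cut en X = {}"
  have finV: "finite V" and edge: "\<And>e. e \<in> ground M \<Longrightarrow> is_edge (en e)"
    and indep: "\<And>I. I \<subseteq> ground M \<Longrightarrow> I \<in> indeps M \<longleftrightarrow> forest en I"
    using rep by (auto simp: represents_def)
  obtain e where e: "e \<in> ground M" "e \<in> cut en X" using X(2) by blast
  then have "e \<notin> B" using disjoint by blast
  then have "insert e B \<notin> indeps M" using B(1) unfolding basis_def by blast
  then obtain T where T: "T \<subseteq> insert e B" "even_set en T" "T \<noteq> {}"
    using indep[of "insert e B"] e(1) B(2) by (auto simp: forest_def)
  have "forest en B" using indep[OF B(2)] B(1) by (simp add: basis_def)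
  then have "e \<in> T" using T by (auto simp: forest_def)
  then have "T \<inter> cut en X = {e}" using T(1) disjoint e(2) by auto
  moreover have "even (card (T \<inter> cut en X))"
    by (rule even_card_Int_cut[OF T(2) finite_subset[OF X(1) finV]])
      (use T(1) B(2) e(1) edge in auto)
  ultimately show False by simp
qed

lemma cut_sym_diff_iff:
  assumes "is_edge (en e)"
  shows "e \<in> cut en (sym_diff X Y) \<longleftrightarrow> (e \<in> cut en X \<longleftrightarrow> e \<notin> cut en Y)"
proof -
  obtain a b where "en e = {a, b}" using assms by (auto simp: is_edge_def)
  then have "e \<in> cut en Z \<longleftrightarrow> (a \<in> Z \<longleftrightarrow> b \<notin> Z)" for Z by (auto simp: cut_def)
  then show ?thesis by auto
qed

lemma card_vertices_eq_Suc_card_basis: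
  assumes rep: "represents M V en" and conn: "connected_edges V (ground M) en"
    and B: "basis M B" "B \<subseteq> ground M" "finite B"
  shows "card V = card B + 1"
proof (rule antisym)
  have V: "finite V" "V \<noteq> {}" and edge: "\<And>e. e \<in> ground M \<Longrightarrow> is_edge (en e) \<and> en e \<subseteq> V"
    using rep by (auto simp: represents_def)
  obtain w where w: "w \<in> V" using V by blast
  have "inj_on (\<lambda>X. B \<inter> cut en X) (Pow (V - {w}))"
  proof (rule inj_onI, rule ccontr)
    fix X Y assume XY: "X \<in> Pow (V - {w})" "Y \<in> Pow (V - {w})" "B \<inter> cut en X = B \<inter> cut en Y" "X \<noteq> Y"
    let ?Z = "sym_diff X Y"
    have Z: "?Z \<subseteq> V" "?Z \<noteq> {}" "?Z \<noteq> V" using XY w by auto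
    then have "ground M \<inter> cut en ?Z \<noteq> {}" using conn by (simp add: connected_edges_def)
    then have "B \<inter> cut en ?Z \<noteq> {}" using cut_meets_basis[OF rep B(1,2) Z(1)] by blast
    then show False using XY(3) B(2) edge cut_sym_diff_iff[of en _ X Y] by blast
  qed
  then have "card (Pow (V - {w})) \<le> card (Pow B)"
    using B(3) by (intro card_inj_on_le) auto
  then have "card (V - {w}) \<le> card B" using B(3) V by (simp add: card_Pow)
  then show "card V \<le> card B + 1" using w V by simp
  have "card B < card V"
  proof (rule ccontr)
    assume "\<not> card B < card V"
    then have "card V \<le> card B" "B \<noteq> {}" using V by auto
    then have "\<exists>T\<subseteq>B. T \<noteq> {} \<and> even_set en T"
      by (intro exists_even_subset[OF B(3) V(1)]) (use edge B(2) in auto)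
    then show False using rep B(1,2) by (auto simp: represents_def basis_def forest_def)
  qed
  then show "card B + 1 \<le> card V" by simp
qed

lemma (in matroid) cut_dependent_if_dual_represented:
  assumes rep: "represents (dual M) V en" and X: "X \<subseteq> V" "ground M \<inter> cut en X \<noteq> {}"
  shows "ground M \<inter> cut en X \<notin> indeps M"
proof
  have ground: "ground (dual M) = ground M" by (simp add: dual_def)
  assume "ground M \<inter> cut en X \<in> indeps M"
  then obtain B where B: "basis (dual M) B" "B \<subseteq> ground M" "(ground M \<inter> cut en X) \<inter> B = {}"
    using indep_disjoint_dual_basis by blast
  then show False using cut_meets_basis[OF rep B(1)] X unfolding ground by blast
qed

section \<open>Rainbow 4-tuples\<close>

definition rainbow_4_tuple :: "('e set \<Rightarrow> bool) \<Rightarrow> ('e \<Rightarrow> nat) \<Rightarrow> nat \<Rightarrow> 'e set list \<Rightarrow> bool" where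
  "rainbow_4_tuple D c n As \<longleftrightarrow> length As = 4 \<and> (\<forall>A\<in>set As. D A \<and> inj_on c A) \<and>
    (\<Sum>A\<leftarrow>As. card A) \<le> n \<and> (\<forall>e. (\<Sum>A\<leftarrow>As. of_bool (e \<in> A)) \<le> (2 :: nat))"

lemma rainbow_4_tuple_mono:
  "rainbow_4_tuple D c n As \<Longrightarrow> (\<And>A. D A \<Longrightarrow> D' A) \<Longrightarrow> rainbow_4_tuple D' c n As"
  by (auto simp: rainbow_4_tuple_def)

lemma rainbow_4_tuple_doubled_pair:
  assumes "D A" "inj_on c A" "D B" "inj_on c B" "A \<inter> B = {}" "2 * (card A + card B) \<le> n"
  shows "rainbow_4_tuple D c n [A, A, B, B]"
  using assms by (auto simp: rainbow_4_tuple_def)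

lemma (in matroid) short_rainbow_circuit_4_tuple_if_dependent:
  assumes "rainbow_4_tuple (\<lambda>A. A \<subseteq> ground M \<and> A \<notin> indeps M) c (2 * matroid_rank M + 4) As"
  shows "\<exists>C. short_rainbow_circuit_4_tuple M c C"
proof -
  have len: "length As = 4" and dep: "\<And>A. A \<in> set As \<Longrightarrow> A \<subseteq> ground M \<and> A \<notin> indeps M"
    and rainbow: "\<And>A. A \<in> set As \<Longrightarrow> inj_on c A"
    and short: "(\<Sum>A\<leftarrow>As. card A) \<le> 2 * matroid_rank M + 4"
    and twice: "\<And>e. (\<Sum>A\<leftarrow>As. of_bool (e \<in> A)) \<le> (2 :: nat)"
    using assms by (auto simp: rainbow_4_tuple_def)
  have "\<forall>A\<in>set As. \<exists>C\<subseteq>A. circuit M C" using dependent_contains_circuit dep by blast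
  then obtain circ where circ: "\<And>A. A \<in> set As \<Longrightarrow> circ A \<subseteq> A \<and> circuit M (circ A)" by metis
  define C where "C i = circ (As ! (i - 1))" for i
  have "As ! (i - 1) \<in> set As" if "i \<in> {1..4}" for i using that len by auto
  then have "rainbow_circuit M c (C i)" if "i \<in> {1..4}" for i
    using that circ rainbow inj_on_subset by (metis C_def rainbow_circuit_def)
  moreover have sum_C: "(\<Sum>i = 1..4. f (C i)) = (\<Sum>A\<leftarrow>As. f (circ A))" for f :: "'a set \<Rightarrow> nat"
    using len by (simp add: sum_list_sum_nth C_def sum.atLeast1_atMost_eq atLeast0LessThan)
  have "(\<Sum>i = 1..4. card (C i)) \<le> (\<Sum>A\<leftarrow>As. card A)"
    unfolding sum_C using circ dep finite_ground
    by (intro sum_list_mono card_mono) (auto dest: finite_subset)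
  moreover have "card {i \<in> {1..4}. e \<in> C i} \<le> 2" for e
  proof -
    have "card {i \<in> {1..4}. e \<in> C i} = (\<Sum>i = 1..4. of_bool (e \<in> C i))"
      by (simp add: of_bool_def sum.If_cases Int_def)
    also have "\<dots> = (\<Sum>A\<leftarrow>As. of_bool (e \<in> circ A))" by (rule sum_C)
    also have "\<dots> \<le> (\<Sum>A\<leftarrow>As. of_bool (e \<in> A))" using circ by (intro sum_list_mono) auto
    finally show ?thesis using twice[of e] by linarith
  qed
  ultimately show ?thesis using short unfolding short_rainbow_circuit_4_tuple_def
    by (intro exI[of _ C]) auto
qed

section \<open>Two-uniform colourings\<close>

locale two_uniform_colouring =
  fixes E :: "'e set" and c :: "'e \<Rightarrow> nat" and m :: nat
  assumes finite_E: "finite E"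
    and colour_range: "e \<in> E \<Longrightarrow> c e \<in> {1..m}"
    and card_colour_class: "s \<in> {1..m} \<Longrightarrow> card {e\<in>E. c e = s} = 2"
begin

lemma card_colour_preimage:
  assumes "K \<subseteq> {1..m}"
  shows "card {e\<in>E. c e \<in> K} = 2 * card K"
proof -
  have "card {e\<in>E. c e \<in> K} = card (\<Union>s\<in>K. {e\<in>E. c e = s})" by (rule arg_cong[of _ _ card]) auto
  also have "\<dots> = (\<Sum>s\<in>K. card {e\<in>E. c e = s})"
    using assms finite_E finite_subset[OF assms] by (intro card_UN_disjoint) auto
  also have "\<dots> = (\<Sum>s\<in>K. 2)" using assms card_colour_class by (intro sum.cong) auto
  finally show ?thesis by simp
qed

lemma card_E: "card E = 2 * m"
proof -
  have "{e\<in>E. c e \<in> {1..m}} = E" using colour_range by blast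
  then show ?thesis using card_colour_preimage[of "{1..m}"] by simp
qed

lemma card_rainbow_le:
  assumes "S \<subseteq> E" "inj_on c S"
  shows "card S \<le> m"
  using card_inj_on_le[OF assms(2), of "{1..m}"] assms(1) colour_range by fastforce

lemma rainbow_transversal:
  assumes "\<And>s. s \<in> {1..m} \<Longrightarrow> \<exists>e\<in>E. c e = s \<and> P e"
  shows "\<exists>R\<subseteq>E. inj_on c R \<and> card R = m \<and> (\<forall>e\<in>R. P e)"
proof -
  obtain f where f: "\<And>s. s \<in> {1..m} \<Longrightarrow> f s \<in> E \<and> c (f s) = s \<and> P (f s)" using assms by metis
  then have "inj_on f {1..m}" by (metis inj_onI)
  then have "card (f ` {1..m}) = m" by (simp add: card_image)
  moreover have "inj_on c (f ` {1..m})" using f by (auto simp: inj_on_def)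
  ultimately show ?thesis using f by (intro exI[of _ "f ` {1..m}"]) blast
qed

definition partner :: "'e \<Rightarrow> 'e" where
  "partner e = the_elem ({f\<in>E. c f = c e} - {e})"

lemma colour_class_eq:
  assumes "e \<in> E"
  shows "{f\<in>E. c f = c e} = {e, partner e}" "partner e \<noteq> e"
proof -
  have "card {f\<in>E. c f = c e} = 2" using card_colour_class colour_range[OF assms] by blast
  then have "card ({f\<in>E. c f = c e} - {e}) = 1" using assms by simp
  then obtain f where f: "{f\<in>E. c f = c e} - {e} = {f}" by (rule card_1_singletonE)
  then have "partner e = f" by (simp add: partner_def)
  then show "{f\<in>E. c f = c e} = {e, partner e}" "partner e \<noteq> e" using f assms by blast+
qed

lemma partner_in_E: "e \<in> E \<Longrightarrow> partner e \<in> E"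
  and colour_partner: "e \<in> E \<Longrightarrow> c (partner e) = c e"
  using colour_class_eq by blast+

lemma same_colourD: "e \<in> E \<Longrightarrow> f \<in> E \<Longrightarrow> c f = c e \<Longrightarrow> f = e \<or> f = partner e"
  using colour_class_eq by blast

lemma partner_partner: "e \<in> E \<Longrightarrow> partner (partner e) = e"
  using same_colourD[of "partner e" e] colour_class_eq(2)[of e] partner_in_E colour_partner by auto

end

lemma (in matroid) two_uniform_colouring_ground:
  assumes "colouring M k c" "two_uniform M k c"
  shows "two_uniform_colouring (ground M) c k"
  by unfold_locales (use assms finite_ground in \<open>auto simp: colouring_def two_uniform_def\<close>)

section \<open>Rainbow vertex cuts\<close>

lemma partition_on_merge:
  assumes "partition_on V \<P>" "P \<in> \<P>" "Q \<in> \<P>" "P \<noteq> Q" and "finite V"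
  shows "partition_on V (insert (P \<union> Q) (\<P> - {P, Q}))"
    "card (insert (P \<union> Q) (\<P> - {P, Q})) = card \<P> - 1"
proof -
  have disj: "disjnt A B" if "A \<in> \<P>" "B \<in> \<P>" "A \<noteq> B" for A B
    using partition_onD2[OF assms(1)] that by (simp add: pairwise_def)
  have empty: "{} \<notin> \<P>" by (rule partition_onD3[OF assms(1)])
  show "partition_on V (insert (P \<union> Q) (\<P> - {P, Q}))"
  proof (rule partition_onI)
    show "\<Union>(insert (P \<union> Q) (\<P> - {P, Q})) = V" using partition_onD1[OF assms(1)] assms(2,3) by auto
    show "{} \<notin> insert (P \<union> Q) (\<P> - {P, Q})" using empty assms(2) by auto
    have merged: "disjnt (P \<union> Q) R" if "R \<in> \<P> - {P, Q}" for R
      using disj[of P R] disj[of Q R] that assms(2,3) by (auto simp: disjnt_Un1)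
    fix A B assume AB: "A \<in> insert (P \<union> Q) (\<P> - {P, Q})" "B \<in> insert (P \<union> Q) (\<P> - {P, Q})" "A \<noteq> B"
    then consider "A = P \<union> Q" "B \<in> \<P> - {P, Q}" | "B = P \<union> Q" "A \<in> \<P> - {P, Q}" | "A \<in> \<P>" "B \<in> \<P>"
      by blast
    then show "disjnt A B" by cases (use merged disj AB(3) disjnt_sym in blast)+
  qed
  have "P \<union> Q \<notin> \<P> - {P, Q}"
  proof
    assume "P \<union> Q \<in> \<P> - {P, Q}"
    then have "disjnt (P \<union> Q) P" using disj[of "P \<union> Q" P] assms(2) by blast
    then show False using assms(2) empty by (auto simp: disjnt_def)
  qed
  moreover have "finite \<P>" by (rule finite_elements[OF assms(5,1)])
  moreover have "card {P, Q} \<le> card \<P>" using assms(2,3) \<open>finite \<P>\<close> by (intro card_mono) auto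
  ultimately show "card (insert (P \<union> Q) (\<P> - {P, Q})) = card \<P> - 1"
    using assms(2-4) by (simp add: card_Diff_subset)
qed

locale coloured_multigraph = two_uniform_colouring E c m
  for E :: "'e set" and c :: "'e \<Rightarrow> nat" and m :: nat +
  fixes V :: "'v set" and en :: "'e \<Rightarrow> 'v set"
  assumes finite_V: "finite V" and card_V: "card V = m + 2"
    and is_edge_en: "e \<in> E \<Longrightarrow> is_edge (en e)"
    and three_le_card_cut: "X \<subseteq> V \<Longrightarrow> X \<noteq> {} \<Longrightarrow> X \<noteq> V \<Longrightarrow> 3 \<le> card (E \<inter> cut en X)"
begin

definition edge_cut :: "'e set \<Rightarrow> bool" where
  "edge_cut A \<longleftrightarrow> A \<noteq> {} \<and> (\<exists>X\<subseteq>V. A = E \<inter> cut en X)"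

definition crossing_colours :: "'v set set \<Rightarrow> nat set" where
  "crossing_colours \<P> = c ` {e\<in>E. \<exists>P\<in>\<P>. e \<in> cut en P}"

definition sparse_partition :: "'v set set \<Rightarrow> bool" where
  "sparse_partition \<P> \<longleftrightarrow> partition_on V \<P> \<and> card (crossing_colours \<P>) + 2 \<le> card \<P>"

lemma crossing_colours_subset: "crossing_colours \<P> \<subseteq> {1..m}"
  using colour_range by (auto simp: crossing_colours_def)

lemma finite_crossing_colours: "finite (crossing_colours \<P>)"
  using finite_E by (simp add: crossing_colours_def)

lemma sparse_partition_singletons: "sparse_partition ((\<lambda>v. {v}) ` V)"
proof -
  have "card ((\<lambda>v. {v}) ` V) = m + 2" using card_V by (simp add: card_image)
  moreover have "card (crossing_colours ((\<lambda>v. {v}) ` V)) \<le> m"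
    using card_mono[OF _ crossing_colours_subset] by fastforce
  ultimately show ?thesis by (simp add: sparse_partition_def partition_on_singletons)
qed

lemma blocks_of_crossing_edge:
  assumes "partition_on V \<P>" and e: "e \<in> E" "e \<in> cut en P" "e \<in> cut en Q"
    and PQ: "P \<in> \<P>" "Q \<in> \<P>" "P \<noteq> Q"
  shows "en e \<subseteq> P \<union> Q" "{R\<in>\<P>. e \<in> cut en R} = {P, Q}"
proof -
  have disj: "A \<inter> B = {}" if "A \<in> \<P>" "B \<in> \<P>" "A \<noteq> B" for A B
    using partition_onD2[OF assms(1)] that by (auto simp: pairwise_def disjnt_def)
  obtain a b where "en e = {a, b}" using is_edge_en[OF e(1)] by (auto simp: is_edge_def)
  then show sub: "en e \<subseteq> P \<union> Q" using e(2,3) disj[OF PQ] by (auto simp: cut_def)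
  have "R = P \<or> R = Q" if "R \<in> \<P>" "e \<in> cut en R" for R
    using sub that disj[of R P] disj[of R Q] PQ by (auto simp: cut_def)
  then show "{R\<in>\<P>. e \<in> cut en R} = {P, Q}" using e PQ by blast
qed

lemma sparse_partition_merge:
  assumes sparse: "sparse_partition \<P>" and e: "e \<in> E" "e \<in> cut en P" "e \<in> cut en Q"
    and partner: "partner e \<in> cut en P" "partner e \<in> cut en Q" and PQ: "P \<in> \<P>" "Q \<in> \<P>" "P \<noteq> Q"
  shows "sparse_partition (insert (P \<union> Q) (\<P> - {P, Q}))" (is "sparse_partition ?\<P>")
proof -
  have part: "partition_on V \<P>" and "card (crossing_colours \<P>) + 2 \<le> card \<P>"
    using sparse by (simp_all add: sparse_partition_def)
  note merge = partition_on_merge[OF part PQ finite_V]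
  have "crossing_colours ?\<P> \<subseteq> crossing_colours \<P> - {c e}"
  proof
    fix s assume "s \<in> crossing_colours ?\<P>"
    then obtain g R where g: "g \<in> E" "s = c g" "R \<in> ?\<P>" "g \<in> cut en R"
      by (auto simp: crossing_colours_def)
    have "cut en (P \<union> Q) \<subseteq> cut en P \<union> cut en Q" by (auto simp: cut_def)
    then have "\<exists>R\<in>\<P>. g \<in> cut en R" using g PQ by blast
    then have "s \<in> crossing_colours \<P>" using g by (auto simp: crossing_colours_def)
    moreover have "g \<notin> {e, partner e}"
    proof
      assume "g \<in> {e, partner e}"
      then have "g \<in> cut en P" "g \<in> cut en Q" using e partner by auto
      note blocks = blocks_of_crossing_edge[OF part g(1) this PQ]
      have "R \<noteq> P \<union> Q" using g(4) blocks(1) by (auto simp: cut_def)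
      then show False using g(3,4) blocks(2) by blast
    qed
    then have "s \<noteq> c e" using same_colourD[OF e(1) g(1)] g(2) by auto
    ultimately show "s \<in> crossing_colours \<P> - {c e}" by blast
  qed
  then have "card (crossing_colours ?\<P>) \<le> card (crossing_colours \<P> - {c e})"
    using finite_crossing_colours by (intro card_mono) auto
  moreover have "c e \<in> crossing_colours \<P>" using e PQ by (auto simp: crossing_colours_def)
  then have "card (crossing_colours \<P> - {c e}) < card (crossing_colours \<P>)"
    using finite_crossing_colours by (intro card_Diff1_less)
  ultimately have "card (crossing_colours ?\<P>) + 2 \<le> card ?\<P>"
    using merge(2) \<open>card (crossing_colours \<P>) + 2 \<le> card \<P>\<close> by linarith
  then show ?thesis using merge(1) by (simp add: sparse_partition_def)
qed

end

locale unmergeable_partition = coloured_multigraph +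
  fixes \<P>
  assumes partition: "partition_on V \<P>"
    and card_crossing_colours: "card (crossing_colours \<P>) + 2 \<le> card \<P>"
    and card_blocks: "card \<P> \<le> m + 2"
    and unmergeable: "e \<in> E \<Longrightarrow> P \<in> \<P> \<Longrightarrow> Q \<in> \<P> \<Longrightarrow> P \<noteq> Q \<Longrightarrow> e \<in> cut en P \<inter> cut en Q \<Longrightarrow>
      partner e \<notin> cut en P \<inter> cut en Q"
begin

abbreviation \<delta> where "\<delta> P \<equiv> E \<inter> cut en P"

lemma finite_blocks: "finite \<P>"
  by (rule finite_elements[OF finite_V partition])

lemma block_proper:
  assumes "P \<in> \<P>"
  shows "P \<subseteq> V" "P \<noteq> {}" "P \<noteq> V"
proof -
  show "P \<subseteq> V" "P \<noteq> {}"
    using assms partition_onD1[OF partition] partition_onD3[OF partition] by auto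
  have "\<not> \<P> \<subseteq> {P}" using card_mono[of "{P}" \<P>] card_crossing_colours by fastforce
  then obtain Q where "Q \<in> \<P>" "Q \<noteq> P" by blast
  then have "Q \<subseteq> V" "Q \<noteq> {}" "disjnt P Q"
    using assms partition_onD1[OF partition] partition_onD2[OF partition]
      partition_onD3[OF partition]
    by (auto simp: pairwise_def)
  then show "P \<noteq> V" by (auto simp: disjnt_def)
qed

lemma card_crossed_blocks_le:
  assumes "e \<in> E"
  shows "card {P\<in>\<P>. e \<in> cut en P} \<le> 2"
proof (rule ccontr)
  assume "\<not> ?thesis"
  then have large: "2 < card {P\<in>\<P>. e \<in> cut en P}" by simp
  then obtain B where B: "B \<subseteq> {P\<in>\<P>. e \<in> cut en P}" "card B = 2"
    using obtain_subset_with_card_n[of 2] by (metis less_imp_le)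
  then obtain P Q where "B = {P, Q}" "P \<noteq> Q" by (auto simp: card_2_iff)
  then have "{P\<in>\<P>. e \<in> cut en P} = {P, Q}"
    using B(1) by (intro blocks_of_crossing_edge(2)[OF partition assms]) auto
  then show False using large \<open>P \<noteq> Q\<close> by simp
qed

lemma sum_card_cuts_le: "(\<Sum>P\<in>\<P>. card (\<delta> P)) \<le> 4 * card (crossing_colours \<P>)"
proof -
  define F where "F = {e\<in>E. c e \<in> crossing_colours \<P>}"
  have "\<delta> P = {e\<in>F. e \<in> cut en P}" if "P \<in> \<P>" for P
    using that by (auto simp: F_def crossing_colours_def)
  then have "(\<Sum>P\<in>\<P>. card (\<delta> P)) = (\<Sum>P\<in>\<P>. card {e\<in>F. e \<in> cut en P})" by simp
  also have "\<dots> = (\<Sum>e\<in>F. card {P\<in>\<P>. e \<in> cut en P})"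
    using finite_blocks finite_E by (intro sum_multicount_gen) (auto simp: F_def)
  also have "\<dots> \<le> (\<Sum>e\<in>F. 2)" by (intro sum_mono card_crossed_blocks_le) (simp add: F_def)
  also have "\<dots> = 4 * card (crossing_colours \<P>)"
    using card_colour_preimage[OF crossing_colours_subset] by (simp add: F_def)
  finally show ?thesis .
qed

lemma sum_card_cuts_subset_le:
  assumes "\<Q> \<subseteq> \<P>"
  shows "(\<Sum>P\<in>\<Q>. card (\<delta> P)) + 8 \<le> card \<P> + 3 * card \<Q>"
proof -
  have "(\<Sum>P\<in>\<P>. card (\<delta> P)) = (\<Sum>P\<in>\<P> - \<Q>. card (\<delta> P)) + (\<Sum>P\<in>\<Q>. card (\<delta> P))"
    using assms finite_blocks by (rule sum.subset_diff)
  moreover have "(\<Sum>P\<in>\<P> - \<Q>. 3) \<le> (\<Sum>P\<in>\<P> - \<Q>. card (\<delta> P))"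
    by (intro sum_mono three_le_card_cut) (use block_proper in auto)
  moreover have "card (\<P> - \<Q>) = card \<P> - card \<Q>" "card \<Q> \<le> card \<P>"
    using assms finite_blocks by (auto simp: card_Diff_subset finite_subset card_mono)
  ultimately show ?thesis using sum_card_cuts_le card_crossing_colours by simp
qed

definition rainbow_blocks :: "'b set set" where
  "rainbow_blocks = {P\<in>\<P>. inj_on c (\<delta> P)}"

definition shared_colours :: "nat set" where
  "shared_colours = c ` {e\<in>E. \<exists>P\<in>rainbow_blocks. \<exists>Q\<in>rainbow_blocks. P \<noteq> Q \<and>
    e \<in> cut en P \<and> e \<in> cut en Q}"

text \<open>The map sends a block to a colour that is repeated in its cut.\<close>

lemma repeated_colours_not_shared:
  "\<exists>\<kappa>. inj_on \<kappa> (\<P> - rainbow_blocks) \<and> \<kappa> ` (\<P> - rainbow_blocks) \<subseteq> crossing_colours \<P> - shared_colours"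
proof -
  let ?R = "rainbow_blocks"
  have "\<exists>e\<in>E. e \<in> cut en P \<and> partner e \<in> cut en P" if "P \<in> \<P> - ?R" for P
  proof -
    obtain e f where "e \<in> \<delta> P" "f \<in> \<delta> P" "c e = c f" "e \<noteq> f"
      using \<open>P \<in> \<P> - ?R\<close> unfolding rainbow_blocks_def inj_on_def by blast
    then show ?thesis using same_colourD[of e f] by auto
  qed
  then obtain g where g: "\<And>P. P \<in> \<P> - ?R \<Longrightarrow> g P \<in> E \<and> g P \<in> cut en P \<and> partner (g P) \<in> cut en P"
    by metis
  have whole_class: "e \<in> cut en P" if "P \<in> \<P> - ?R" "e \<in> E" "c e = c (g P)" for P e
    using g[OF that(1)] same_colourD[of "g P" e] that(2,3) by blast
  have "inj_on (c \<circ> g) (\<P> - ?R)"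
  proof (rule inj_onI, rule ccontr)
    fix P Q assume PQ: "P \<in> \<P> - ?R" "Q \<in> \<P> - ?R" "(c \<circ> g) P = (c \<circ> g) Q" "P \<noteq> Q"
    then have "g P \<in> cut en Q" "partner (g P) \<in> cut en Q"
      using g[OF PQ(1)] whole_class[OF PQ(2)] partner_in_E colour_partner by auto
    then show False using unmergeable[of "g P" P Q] g[OF PQ(1)] PQ by blast
  qed
  moreover have "(c \<circ> g) ` (\<P> - ?R) \<subseteq> crossing_colours \<P> - shared_colours"
  proof (intro image_subsetI DiffI)
    fix P assume P: "P \<in> \<P> - ?R"
    then show "(c \<circ> g) P \<in> crossing_colours \<P>" using g[OF P] by (auto simp: crossing_colours_def)
    show "(c \<circ> g) P \<notin> shared_colours"
    proof
      assume "(c \<circ> g) P \<in> shared_colours"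
      then obtain e A B where e: "e \<in> E" "c e = c (g P)" "A \<in> ?R" "B \<in> ?R" "A \<noteq> B" "e \<in> cut en A"
        "e \<in> cut en B"
        unfolding shared_colours_def comp_apply by (elim imageE CollectE) metis
      then have "e \<in> cut en P" using whole_class[OF P] by blast
      moreover have "A \<in> \<P>" "B \<in> \<P>" using e(3,4) by (auto simp: rainbow_blocks_def)
      then have "{S\<in>\<P>. e \<in> cut en S} = {A, B}"
        by (rule blocks_of_crossing_edge(2)[OF partition e(1,6,7) _ _ e(5)])
      ultimately have "P = A \<or> P = B" using P by auto
      then show False using P e(3,4) by auto
    qed
  qed
  ultimately show ?thesis by blast
qed

lemma card_shared_colours_less: "card shared_colours + 2 \<le> card rainbow_blocks"
proof -
  let ?R = "rainbow_blocks" and ?X = "crossing_colours \<P>"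
  have R: "?R \<subseteq> \<P>" by (auto simp: rainbow_blocks_def)
  obtain \<kappa> where "inj_on \<kappa> (\<P> - ?R)" "\<kappa> ` (\<P> - ?R) \<subseteq> ?X - shared_colours"
    using repeated_colours_not_shared by blast
  then have "card (\<P> - ?R) \<le> card (?X - shared_colours)"
    using finite_crossing_colours by (intro card_inj_on_le) auto
  moreover have "shared_colours \<subseteq> ?X"
    using R by (auto simp: shared_colours_def crossing_colours_def)
  then have "card (?X - shared_colours) = card ?X - card shared_colours"
    "card shared_colours \<le> card ?X"
    using finite_crossing_colours by (auto simp: card_Diff_subset finite_subset card_mono)
  moreover have "card (\<P> - ?R) = card \<P> - card ?R" "card ?R \<le> card \<P>"
    using R finite_blocks by (auto simp: card_Diff_subset finite_subset card_mono)
  ultimately show ?thesis using card_crossing_colours by linarith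
qed

text \<open>Otherwise all pairs of rainbow blocks are joined by edges of shared colours, so that
  \<open>k (k - 1) / 2 \<le> 2 (k - 2)\<close> for the number \<open>k\<close> of rainbow blocks.\<close>

lemma nonadjacent_rainbow_blocks:
  "\<exists>P\<in>rainbow_blocks. \<exists>Q\<in>rainbow_blocks. P \<noteq> Q \<and> \<delta> P \<inter> \<delta> Q = {}"
proof (rule ccontr)
  assume adjacent: "\<not> ?thesis"
  let ?R = "rainbow_blocks" and ?F = "{e\<in>E. c e \<in> shared_colours}"
  let ?pairs = "{B. B \<subseteq> ?R \<and> card B = 2}"
  have R: "?R \<subseteq> \<P>" by (auto simp: rainbow_blocks_def)
  have "\<forall>B\<in>?pairs. \<exists>e. e \<in> ?F \<and> {P\<in>\<P>. e \<in> cut en P} = B"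
  proof
    fix B assume "B \<in> ?pairs"
    obtain P Q where PQ: "B = {P, Q}" "P \<noteq> Q" "P \<in> ?R" "Q \<in> ?R"
      using \<open>B \<in> ?pairs\<close> by (auto simp: card_2_iff)
    then obtain e where e: "e \<in> E" "e \<in> cut en P" "e \<in> cut en Q" using adjacent by blast
    then have "{P\<in>\<P>. e \<in> cut en P} = B"
      using blocks_of_crossing_edge(2)[OF partition e] PQ R by blast
    moreover have "c e \<in> shared_colours" using e PQ by (auto simp: shared_colours_def)
    ultimately show "\<exists>e. e \<in> ?F \<and> {P\<in>\<P>. e \<in> cut en P} = B" using e(1) by blast
  qed
  from bchoice[OF this] obtain g where g: "\<forall>B\<in>?pairs. g B \<in> ?F \<and> {P\<in>\<P>. g B \<in> cut en P} = B" ..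
  have "inj_on g ?pairs" by (rule inj_on_inverseI[of _ "\<lambda>e. {P\<in>\<P>. e \<in> cut en P}"]) (use g in blast)
  moreover have "g ` ?pairs \<subseteq> ?F" using g by blast
  ultimately have "card ?pairs \<le> card ?F" using finite_E by (intro card_inj_on_le) auto
  moreover have "shared_colours \<subseteq> {1..m}" using colour_range by (auto simp: shared_colours_def)
  then have "card ?F = 2 * card shared_colours" by (rule card_colour_preimage)
  moreover have "card ?pairs = card ?R choose 2"
    using n_subsets finite_subset[OF R finite_blocks] by blast
  ultimately have "card ?R choose 2 \<le> 2 * (card ?R - 2)" "2 \<le> card ?R"
    using card_shared_colours_less by linarith+
  then obtain j where "(j + 2) choose 2 \<le> 2 * j" by (metis diff_add)
  then have "(j + 2) * (j + 1) \<le> 4 * j + 1" by (simp add: choose_two)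
  moreover have "j \<le> j * j" by (rule le_square)
  ultimately show False by simp
qed

lemma rainbow_4_tuple_if_unmergeable:
  "\<exists>As. rainbow_4_tuple edge_cut c (2 * m + 2) As"
proof -
  obtain P Q where PQ: "P \<in> rainbow_blocks" "Q \<in> rainbow_blocks" "P \<noteq> Q" "\<delta> P \<inter> \<delta> Q = {}"
    using nonadjacent_rainbow_blocks by blast
  have cut: "edge_cut (\<delta> P) \<and> inj_on c (\<delta> P)" if "P \<in> rainbow_blocks" for P
  proof -
    have "P \<in> \<P>" "inj_on c (\<delta> P)" using that by (auto simp: rainbow_blocks_def)
    moreover from this have "3 \<le> card (\<delta> P)" using block_proper by (intro three_le_card_cut)
    moreover from this have "\<delta> P \<noteq> {}" by auto
    ultimately show ?thesis using block_proper(1)[of P] unfolding edge_cut_def by blast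
  qed
  have "(\<Sum>P\<in>{P, Q}. card (\<delta> P)) + 8 \<le> card \<P> + 3 * card {P, Q}"
    using PQ by (intro sum_card_cuts_subset_le) (auto simp: rainbow_blocks_def)
  then have "2 * (card (\<delta> P) + card (\<delta> Q)) \<le> 2 * m + 2" using PQ(3) card_blocks by simp
  then show ?thesis
    by (intro exI[of _ "[\<delta> P, \<delta> P, \<delta> Q, \<delta> Q]"] rainbow_4_tuple_doubled_pair)
      (use cut[OF PQ(1)] cut[OF PQ(2)] PQ(4) in simp_all)
qed

end

theorem (in coloured_multigraph) rainbow_4_tuple_of_edge_cuts:
  "\<exists>As. rainbow_4_tuple edge_cut c (2 * m + 2) As"
proof -
  obtain \<P> where \<P>: "sparse_partition \<P>" and least: "\<And>\<Q>. sparse_partition \<Q> \<Longrightarrow> card \<P> \<le> card \<Q>"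
    using ex_has_least_nat[of sparse_partition _ card] sparse_partition_singletons by blast
  have part: "partition_on V \<P>" "card (crossing_colours \<P>) + 2 \<le> card \<P>"
    using \<P> by (simp_all add: sparse_partition_def)
  interpret unmergeable_partition E c m V en \<P>
  proof
    show "card \<P> \<le> m + 2"
      using least[OF sparse_partition_singletons] card_V by (simp add: card_image)
    show "partner e \<notin> cut en P \<inter> cut en Q"
      if "e \<in> E" "P \<in> \<P>" "Q \<in> \<P>" "P \<noteq> Q" "e \<in> cut en P \<inter> cut en Q" for e P Q
    proof
      assume "partner e \<in> cut en P \<inter> cut en Q"
      then have "sparse_partition (insert (P \<union> Q) (\<P> - {P, Q}))"
        using that by (intro sparse_partition_merge[OF \<P>]) auto
      then have "card \<P> \<le> card \<P> - 1"
        using least partition_on_merge(2)[OF part(1) that(2-4) finite_V] by metis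
      then show False using part(2) by simp
    qed
  qed (use part in auto)
  show ?thesis by (rule rainbow_4_tuple_if_unmergeable)
qed

section \<open>Cycles of simple graphs\<close>

definition support :: "('e \<Rightarrow> 'v set) \<Rightarrow> 'e set \<Rightarrow> 'v set" where
  "support en T = \<Union>(en ` T)"

lemma support_mono: "T \<subseteq> U \<Longrightarrow> support en T \<subseteq> support en U"
  by (auto simp: support_def)

lemma ends_subset_support: "e \<in> T \<Longrightarrow> en e \<subseteq> support en T"
  by (auto simp: support_def)

locale simple_graph =
  fixes V :: "'v set" and E :: "'e set" and en :: "'e \<Rightarrow> 'v set"
  assumes finite_V: "finite V" and ends_subset: "e \<in> E \<Longrightarrow> en e \<subseteq> V"
    and card_ends: "e \<in> E \<Longrightarrow> card (en e) = 2" and inj_ends: "inj_on en E"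
begin

lemma finite_edges: "T \<subseteq> E \<Longrightarrow> finite T"
  by (rule inj_on_finite[OF inj_on_subset[OF inj_ends], of T "Pow V"])
    (use ends_subset finite_V in auto)

lemma ends_eqD: "e \<in> E \<Longrightarrow> f \<in> E \<Longrightarrow> en e = en f \<Longrightarrow> e = f"
  using inj_ends by (auto dest: inj_onD)

lemma is_edge_ends: "e \<in> E \<Longrightarrow> is_edge (en e)"
  using card_ends[of e] by (auto simp: is_edge_def card_2_iff)

lemma other_end:
  assumes "e \<in> E" "v \<in> en e"
  obtains u where "en e = {v, u}" "u \<noteq> v"
  using card_ends[OF assms(1)] assms(2) by (auto simp: card_2_iff doubleton_eq_iff)

lemma degree_eq:
  assumes "T \<subseteq> E"
  shows "degree en T v = card {e\<in>T. v \<in> en e}"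
proof -
  have "\<not> en e \<subseteq> {v}" if "e \<in> T" for e
    using card_ends[of e] card_mono[of "{v}" "en e"] that assms by fastforce
  then have "T \<inter> cut en {v} = {e\<in>T. v \<in> en e}" by (auto simp: cut_def)
  then show ?thesis by (simp add: degree_def)
qed

lemma support_subset_V: "T \<subseteq> E \<Longrightarrow> support en T \<subseteq> V"
  using ends_subset by (auto simp: support_def)

lemma finite_support: "T \<subseteq> E \<Longrightarrow> finite (support en T)"
  using finite_subset[OF support_subset_V finite_V] .

lemma sum_degree:
  assumes T: "T \<subseteq> E" and W: "support en T \<subseteq> W" "finite W"
  shows "(\<Sum>v\<in>W. degree en T v) = 2 * card T"
proof -
  have "card {v\<in>W. v \<in> en e} = 2" if "e \<in> T" for e
  proof -
    have "en e \<subseteq> W" using ends_subset_support[OF that] W(1) by (rule subset_trans)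
    then have "{v\<in>W. v \<in> en e} = en e" by auto
    then show ?thesis using card_ends that T by auto
  qed
  then have "(\<Sum>v\<in>W. card {e\<in>T. v \<in> en e}) = (\<Sum>e\<in>T. 2)"
    using W(2) finite_edges[OF T] by (intro sum_multicount_gen) auto
  then show ?thesis by (simp add: degree_eq[OF T])
qed

lemma degree_pos_iff: "T \<subseteq> E \<Longrightarrow> 0 < degree en T v \<longleftrightarrow> v \<in> support en T"
  using finite_edges by (auto simp: degree_eq support_def card_gt_0_iff)

lemma degree_mono: "T \<subseteq> U \<Longrightarrow> U \<subseteq> E \<Longrightarrow> degree en T v \<le> degree en U v"
  unfolding degree_def using finite_edges by (intro card_mono) auto

lemma two_le_degree_even_set:
  assumes "T \<subseteq> E" "even_set en T" "v \<in> support en T"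
  shows "2 \<le> degree en T v"
proof -
  have "0 < degree en T v" "even (degree en T v)"
    using assms by (auto simp: degree_pos_iff even_set_def)
  then show ?thesis by (auto elim!: evenE)
qed

lemma even_set_other_edge:
  assumes T: "T \<subseteq> E" "even_set en T" and e: "e \<in> T" "v \<in> en e"
  shows "\<exists>f\<in>T. f \<noteq> e \<and> v \<in> en f"
proof -
  have "2 \<le> card {f\<in>T. v \<in> en f}"
    using two_le_degree_even_set[OF T, of v] e T(1) by (auto simp: degree_eq support_def)
  then have "\<not> {f\<in>T. v \<in> en f} \<subseteq> {e}" using card_mono[of "{e}" "{f\<in>T. v \<in> en f}"] by fastforce
  then show ?thesis by blast
qed

lemma card_support_le:
  assumes "T \<subseteq> E" "\<And>v. v \<in> support en T \<Longrightarrow> 2 \<le> degree en T v"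
  shows "card (support en T) \<le> card T"
proof -
  have "(\<Sum>v\<in>support en T. 2) \<le> (\<Sum>v\<in>support en T. degree en T v)"
    using assms by (intro sum_mono) auto
  then show ?thesis using sum_degree[OF assms(1) subset_refl finite_support[OF assms(1)]] by simp
qed

lemma three_le_card_even_set:
  assumes T: "T \<subseteq> E" "even_set en T" "T \<noteq> {}"
  shows "3 \<le> card T"
proof -
  obtain e where e: "e \<in> T" using T by blast
  then obtain a b where ab: "en e = {a, b}" "a \<noteq> b"
    using card_ends[of e] T by (auto simp: card_2_iff)
  obtain f where f: "f \<in> T" "f \<noteq> e" "a \<in> en f"
    using even_set_other_edge[OF T(1,2) e, of a] ab by blast
  then obtain x where x: "en f = {a, x}" "x \<noteq> a" using other_end T by blast
  have "x \<noteq> b" using ends_eqD[of e f] x ab f e T by auto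
  then have "card {a, b, x} = 3" using ab x by simp
  moreover have "{a, b, x} \<subseteq> support en T" using x ab e f by (auto simp: support_def)
  ultimately have "3 \<le> card (support en T)" using card_mono[OF finite_support[OF T(1)]] by metis
  also have "\<dots> \<le> card T" using two_le_degree_even_set[OF T(1,2)] by (rule card_support_le[OF T(1)])
  finally show ?thesis .
qed

lemma bicyclic_if_card_support_less:
  "S \<subseteq> E \<Longrightarrow> support en S \<subseteq> W \<Longrightarrow> finite W \<Longrightarrow> card W < card S \<Longrightarrow> bicyclic en S"
  using finite_edges is_edge_ends by (intro bicyclic_if_card_less[of S W]) (auto simp: support_def)

lemma exists_even_subset_if_card_support_le:
  "S \<subseteq> E \<Longrightarrow> support en S \<subseteq> W \<Longrightarrow> finite W \<Longrightarrow> card W \<le> card S \<Longrightarrow> S \<noteq> {} \<Longrightarrow>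
    \<exists>T\<subseteq>S. T \<noteq> {} \<and> even_set en T"
  using finite_edges is_edge_ends by (intro exists_even_subset[of S W]) (auto simp: support_def)

definition cyclic :: "'e set \<Rightarrow> bool" where
  "cyclic T \<longleftrightarrow> T \<subseteq> E \<and> T \<noteq> {} \<and> even_set en T"

definition simple_cycle :: "'e set \<Rightarrow> bool" where
  "simple_cycle T \<longleftrightarrow> cyclic T \<and> (\<forall>U\<subseteq>T. even_set en U \<longrightarrow> U = {} \<or> U = T)"

lemma simple_cycleD:
  assumes "simple_cycle T"
  shows "T \<subseteq> E" "T \<noteq> {}" "even_set en T"
  using assms by (auto simp: simple_cycle_def cyclic_def)

lemma simple_cycle_minimal: "simple_cycle T \<Longrightarrow> U \<subseteq> T \<Longrightarrow> even_set en U \<Longrightarrow> U = {} \<or> U = T"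
  by (simp add: simple_cycle_def)

lemma exists_simple_cycle_subset:
  assumes "cyclic T"
  shows "\<exists>C\<subseteq>T. simple_cycle C"
proof -
  have T: "T \<subseteq> E" using assms by (simp add: cyclic_def)
  let ?S = "{C. C \<subseteq> T \<and> cyclic C}"
  have "finite ?S" using finite_edges[OF T] by simp
  then have "\<exists>C\<in>?S. \<forall>U\<in>?S. U \<subseteq> C \<longrightarrow> C = U" by (rule finite_has_minimal) (use assms in auto)
  then obtain C where C: "C \<subseteq> T" "cyclic C" and minimal: "\<forall>U\<in>?S. U \<subseteq> C \<longrightarrow> C = U" by blast
  have "U = {} \<or> U = C" if "U \<subseteq> C" "even_set en U" for U
  proof (cases "U = {}")
    case False
    then have "U \<in> ?S" using that C T by (auto simp: cyclic_def)
    then show ?thesis using minimal that(1) by blast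
  qed simp
  then show ?thesis using C by (auto simp: simple_cycle_def)
qed

lemma degree_simple_cycle:
  assumes "simple_cycle T"
  shows "degree en T v = (if v \<in> support en T then 2 else 0)"
proof -
  note T = simple_cycleD[OF assms]
  have fin: "finite (support en T)" by (rule finite_support[OF T(1)])
  have ge: "2 \<le> degree en T u" if "u \<in> support en T" for u
    using two_le_degree_even_set[OF T(1,3) that] .
  have "degree en T u = 2" if u: "u \<in> support en T" for u
  proof (rule ccontr)
    assume "degree en T u \<noteq> 2"
    then have "(\<Sum>w\<in>support en T. 2) < (\<Sum>w\<in>support en T. degree en T w)"
      using ge u
      by (intro sum_strict_mono_ex1[OF fin]) (auto intro!: bexI[of _ u] simp: le_neq_implies_less)
    then have "card (support en T) < card T" using sum_degree[OF T(1) subset_refl fin] by simp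
    then have "bicyclic en T" by (rule bicyclic_if_card_support_less[OF T(1) subset_refl fin])
    then show False using simple_cycle_minimal[OF assms] unfolding bicyclic_def by blast
  qed
  then show ?thesis using degree_pos_iff[OF T(1), of v] by auto
qed

lemma card_simple_cycle_le:
  assumes "simple_cycle C"
  shows "card C \<le> 2 * card (V - W) + card {h\<in>C. en h \<subseteq> W}"
proof -
  note C = simple_cycleD[OF assms]
  let ?H = "{h\<in>C. en h \<subseteq> W}" and ?at = "\<lambda>v. {e\<in>C. v \<in> en e}"
  have fin: "finite C" by (rule finite_edges[OF C(1)])
  have "C - ?H \<subseteq> (\<Union>v\<in>V - W. ?at v)" using C(1) ends_subset by blast
  then have "card (C - ?H) \<le> card (\<Union>v\<in>V - W. ?at v)" using fin finite_V by (intro card_mono) auto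
  also have "\<dots> \<le> (\<Sum>v\<in>V - W. card (?at v))" using finite_V by (intro card_UN_le) auto
  also have "\<dots> \<le> (\<Sum>v\<in>V - W. 2)"
    using degree_simple_cycle[OF assms]
    by (intro sum_mono) (simp add: degree_eq[OF C(1), symmetric])
  finally have "card (C - ?H) \<le> 2 * card (V - W)" by simp
  moreover have "card C = card (C - ?H) + card ?H"
    using fin by (subst card_Un_disjoint[symmetric]) (auto intro!: arg_cong[where f = card])
  ultimately show ?thesis by linarith
qed

lemma exists_cycle_through_chord:
  assumes X: "simple_cycle X" and h: "h \<in> E" "h \<notin> X" "en h \<subseteq> support en X" and z: "z \<in> X"
  shows "\<exists>T\<subseteq>insert h X. even_set en T \<and> h \<in> T \<and> z \<in> T"
proof -
  note X' = simple_cycleD[OF X]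
  have "card (support en X) \<le> card X"
    using two_le_degree_even_set[OF X'(1,3)] by (rule card_support_le[OF X'(1)])
  moreover have "card (insert h X) = Suc (card X)" using h finite_edges[OF X'(1)] by simp
  ultimately have "bicyclic en (insert h X)"
    using h X'(1) finite_support[OF X'(1)]
    by (intro bicyclic_if_card_support_less[of _ "support en X"]) (auto simp: support_def)
  then obtain P Q where PQ: "P \<subseteq> insert h X" "Q \<subseteq> insert h X" "P \<noteq> {}" "Q \<noteq> {}" "P \<noteq> Q"
    "even_set en P" "even_set en Q"
    by (auto simp: bicyclic_def)
  have "h \<in> P \<or> h \<in> Q"
  proof (rule ccontr)
    assume "\<not> ?thesis"
    then have "P \<subseteq> X" "Q \<subseteq> X" using PQ by auto
    then show False using simple_cycle_minimal[OF X] PQ by metis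
  qed
  then obtain T where T: "T \<subseteq> insert h X" "even_set en T" "h \<in> T" using PQ by blast
  show ?thesis
  proof (cases "z \<in> T")
    case True
    then show ?thesis using T by blast
  next
    case False
    have "even_set en (sym_diff T X)" using T(2) X'(3) by (rule even_set_sym_diff)
    then show ?thesis using False T h z by (intro exI[of _ "sym_diff T X"]) auto
  qed
qed

end

section \<open>Graphs without rainbow bicyclic edge sets\<close>

locale coloured_graph = simple_graph V E en + two_uniform_colouring E c m
  for V :: "'v set" and E :: "'e set" and en :: "'e \<Rightarrow> 'v set" and c :: "'e \<Rightarrow> nat" and m :: nat +
  assumes card_V_le: "card V \<le> m"

locale rainbow_unicyclic_graph = coloured_graph +
  assumes not_bicyclic: "S \<subseteq> E \<Longrightarrow> inj_on c S \<Longrightarrow> \<not> bicyclic en S"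
begin

lemma centred_colour_exists:
  assumes v: "v \<in> V"
  shows "\<exists>s\<in>{1..m}. \<forall>e\<in>E. c e = s \<longrightarrow> v \<in> en e"
proof (rule ccontr)
  assume "\<not> ?thesis"
  then have "\<exists>e\<in>E. c e = s \<and> v \<notin> en e" if "s \<in> {1..m}" for s using that by blast
  then obtain R where R: "R \<subseteq> E" "inj_on c R" "card R = m" "\<forall>e\<in>R. v \<notin> en e"
    using rainbow_transversal[of "\<lambda>e. v \<notin> en e"] by blast
  have "support en R \<subseteq> V - {v}" using R(4) support_subset_V[OF R(1)] by (auto simp: support_def)
  moreover have "card (V - {v}) < card R"
    using card_Diff1_less[OF finite_V v] card_V_le R(3) by linarith
  ultimately have "bicyclic en R"
    using finite_V by (intro bicyclic_if_card_support_less[OF R(1)]) auto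
  then show False using not_bicyclic R(1,2) by blast
qed

definition centred_colour :: "'a \<Rightarrow> nat" where
  "centred_colour v = (SOME s. s \<in> {1..m} \<and> (\<forall>e\<in>E. c e = s \<longrightarrow> v \<in> en e))"

lemma centred_colour:
  assumes "v \<in> V"
  shows "centred_colour v \<in> {1..m}" "\<And>e. e \<in> E \<Longrightarrow> c e = centred_colour v \<Longrightarrow> v \<in> en e"
proof -
  have "\<exists>s. s \<in> {1..m} \<and> (\<forall>e\<in>E. c e = s \<longrightarrow> v \<in> en e)" using centred_colour_exists[OF assms] by blast
  then have "centred_colour v \<in> {1..m} \<and> (\<forall>e\<in>E. c e = centred_colour v \<longrightarrow> v \<in> en e)"
    unfolding centred_colour_def by (rule someI_ex)
  then show "centred_colour v \<in> {1..m}" "\<And>e. e \<in> E \<Longrightarrow> c e = centred_colour v \<Longrightarrow> v \<in> en e" by blast+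
qed

lemma centred_colour_class:
  assumes "v \<in> V"
  obtains e f where "e \<in> E" "f \<in> E" "e \<noteq> f" "c e = centred_colour v" "c f = centred_colour v"
proof -
  have "card {e\<in>E. c e = centred_colour v} = 2"
    by (rule card_colour_class[OF centred_colour(1)[OF assms]])
  then obtain e f where "{e\<in>E. c e = centred_colour v} = {e, f}" "e \<noteq> f" by (auto simp: card_2_iff)
  then show thesis using that[of e f] by blast
qed

lemma inj_on_centred_colour: "inj_on centred_colour V"
proof (rule inj_onI, rule ccontr)
  fix u v assume uv: "u \<in> V" "v \<in> V" "centred_colour u = centred_colour v" "u \<noteq> v"
  obtain e f where ef: "e \<in> E" "f \<in> E" "e \<noteq> f" "c e = centred_colour v" "c f = centred_colour v"
    using centred_colour_class[OF uv(2)] .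
  have "en g = {u, v}" if "g \<in> E" "c g = centred_colour v" for g
  proof -
    have "u \<in> en g" "v \<in> en g" using centred_colour(2) uv that by auto
    then show ?thesis using other_end[OF that(1)] uv(4) by (metis insertE singletonD)
  qed
  then show False using ends_eqD[of e f] ef by simp
qed

definition out_neighbours :: "'a \<Rightarrow> 'a set" where
  "out_neighbours v = {u. \<exists>e\<in>E. c e = centred_colour v \<and> en e = {v, u} \<and> u \<noteq> v}"

lemma out_neighbours_subset: "v \<in> V \<Longrightarrow> out_neighbours v \<subseteq> V - {v}"
  using ends_subset by (auto simp: out_neighbours_def)

lemma two_le_card_out_neighbours:
  assumes v: "v \<in> V"
  shows "2 \<le> card (out_neighbours v)"
proof -
  obtain e f where ef: "e \<in> E" "f \<in> E" "e \<noteq> f" "c e = centred_colour v" "c f = centred_colour v"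
    using centred_colour_class[OF v] .
  obtain a where a: "en e = {v, a}" "a \<noteq> v"
    using other_end[OF ef(1) centred_colour(2)[OF v ef(1,4)]] .
  obtain b where b: "en f = {v, b}" "b \<noteq> v"
    using other_end[OF ef(2) centred_colour(2)[OF v ef(2,5)]] .
  have "a \<noteq> b" using ends_eqD[of e f] ef a b by auto
  moreover have "{a, b} \<subseteq> out_neighbours v" using a b ef by (auto simp: out_neighbours_def)
  moreover have "finite (out_neighbours v)"
    using out_neighbours_subset[OF v] finite_V by (metis finite_Diff finite_subset)
  ultimately show ?thesis using card_mono[of "out_neighbours v" "{a, b}"] by simp
qed

lemma rainbow_cycle_within_sinkless:
  assumes K: "K \<subseteq> V" "K \<noteq> {}" "sinkless out_neighbours K"
  shows "\<exists>F. cyclic F \<and> inj_on c F \<and> card F \<le> card K \<and> support en F \<subseteq> K"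
proof -
  have finK: "finite K" using K(1) finite_V by (rule finite_subset)
  have "\<exists>e. e \<in> E \<and> c e = centred_colour v \<and> en e \<subseteq> K" if v: "v \<in> K" for v
  proof -
    have "out_neighbours v \<inter> K \<noteq> {}" using K(3) v by (simp add: sinkless_def)
    then obtain u where "u \<in> out_neighbours v" "u \<in> K" by blast
    then obtain e where "e \<in> E" "c e = centred_colour v" "en e = {v, u}"
      by (auto simp: out_neighbours_def)
    then show ?thesis using v \<open>u \<in> K\<close> by auto
  qed
  then obtain g where g: "\<And>v. v \<in> K \<Longrightarrow> g v \<in> E \<and> c (g v) = centred_colour v \<and> en (g v) \<subseteq> K" by metis
  have "inj_on centred_colour K" using inj_on_centred_colour K(1) by (rule inj_on_subset)
  then have "inj_on (c \<circ> g) K" using g by (simp add: inj_on_def)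
  then have inj: "inj_on g K" "inj_on c (g ` K)" by (auto intro: inj_on_imageI inj_on_imageI2)
  have gE: "g ` K \<subseteq> E" and gK: "support en (g ` K) \<subseteq> K" using g by (auto simp: support_def)
  have card_g: "card (g ` K) = card K" using inj(1) by (rule card_image)
  obtain F where F: "F \<subseteq> g ` K" "F \<noteq> {}" "even_set en F"
    using exists_even_subset_if_card_support_le[OF gE gK finK] card_g K(2) by auto
  have "card F \<le> card K" using card_mono[OF finite_imageI[OF finK] F(1)] card_g by simp
  moreover have "support en F \<subseteq> K" using support_mono[OF F(1)] gK by (rule subset_trans)
  moreover have "inj_on c F" using inj(2) F(1) by (rule inj_on_subset)
  moreover have "cyclic F" using F(2,3) subset_trans[OF F(1) gE] by (simp add: cyclic_def)
  ultimately show ?thesis by blast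
qed

theorem rainbow_4_tuple_if_unicyclic:
  assumes "V \<noteq> {}"
  shows "\<exists>As. rainbow_4_tuple cyclic c (2 * m + 2) As"
proof -
  obtain K L y where K: "K \<subseteq> V" "L \<subseteq> V" "K \<inter> L = {y}" "sinkless out_neighbours K"
    "sinkless out_neighbours L"
    using thomassen_sinkless_sets_meeting_in_point[OF finite_V assms out_neighbours_subset
        two_le_card_out_neighbours]
    by metis
  have "K \<noteq> {}" "L \<noteq> {}" using K(3) by auto
  obtain A where A: "cyclic A" "inj_on c A" "card A \<le> card K" "support en A \<subseteq> K"
    using rainbow_cycle_within_sinkless[OF K(1) \<open>K \<noteq> {}\<close> K(4)] by blast
  obtain B where B: "cyclic B" "inj_on c B" "card B \<le> card L" "support en B \<subseteq> L"
    using rainbow_cycle_within_sinkless[OF K(2) \<open>L \<noteq> {}\<close> K(5)] by blast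
  have "A \<inter> B = {}"
  proof (rule ccontr)
    assume "A \<inter> B \<noteq> {}"
    then obtain e where e: "e \<in> A" "e \<in> B" by blast
    then have "en e \<subseteq> K \<inter> L"
      using ends_subset_support[of e A en] ends_subset_support[of e B en] A(4) B(4) by blast
    then have "card (en e) \<le> 1" using card_mono[of "{y}" "en e"] K(3) by simp
    then show False using card_ends[of e] e(1) A(1) by (auto simp: cyclic_def)
  qed
  moreover have "card A + card B \<le> m + 1"
  proof -
    have fin: "finite K" "finite L" using K(1,2) finite_V finite_subset by auto
    have "card (K \<union> L) \<le> card V" using K finite_V by (intro card_mono) auto
    then show ?thesis using card_Un_Int[OF fin] K(3) A(3) B(3) card_V_le by simp
  qed
  ultimately show ?thesis
    using A B by (intro exI[of _ "[A, A, B, B]"] rainbow_4_tuple_doubled_pair) auto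
qed

end

section \<open>Minimal rainbow bicyclic edge sets\<close>

locale rainbow_theta = coloured_graph +
  fixes S
  assumes S_subset: "S \<subseteq> E" and inj_on_S: "inj_on c S" and bicyclic_S: "bicyclic en S"
    and least: "\<And>Q. Q \<subseteq> E \<Longrightarrow> inj_on c Q \<Longrightarrow> bicyclic en Q \<Longrightarrow> card S \<le> card Q"
    and crossing: "\<And>X Y. X \<subseteq> S \<Longrightarrow> Y \<subseteq> S \<Longrightarrow> cyclic X \<Longrightarrow> cyclic Y \<Longrightarrow> X \<inter> Y \<noteq> {}"
begin

definition cycles :: "'b set set" where
  "cycles = {X. X \<subseteq> S \<and> cyclic X}"

definition triple :: "'b set \<Rightarrow> 'b set \<Rightarrow> 'b set \<Rightarrow> bool" where
  "triple X Y Z \<longleftrightarrow> X \<in> cycles \<and> Y \<in> cycles \<and> X \<noteq> Y \<and> Z = sym_diff X Y"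

abbreviation VS where "VS \<equiv> support en S"

lemma finite_S: "finite S"
  by (rule finite_edges[OF S_subset])

lemma finite_VS: "finite VS"
  by (rule finite_support[OF S_subset])

lemma cyclesD:
  assumes "X \<in> cycles"
  shows "X \<subseteq> S" "X \<subseteq> E" "X \<noteq> {}" "even_set en X" "finite X" "inj_on c X" "cyclic X"
  using assms S_subset finite_S inj_on_S
  by (auto simp: cycles_def cyclic_def intro: finite_subset inj_on_subset)

lemma cyclesI: "X \<subseteq> S \<Longrightarrow> X \<noteq> {} \<Longrightarrow> even_set en X \<Longrightarrow> X \<in> cycles"
  using S_subset by (auto simp: cycles_def cyclic_def)

lemma cycles_cross: "X \<in> cycles \<Longrightarrow> Y \<in> cycles \<Longrightarrow> X \<inter> Y \<noteq> {}"
  by (rule crossing) (simp_all add: cycles_def)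

lemma simple_cycle_if_cycles:
  assumes X: "X \<in> cycles"
  shows "simple_cycle X"
proof -
  note X' = cyclesD[OF X]
  have "U = {} \<or> U = X" if U: "U \<subseteq> X" "even_set en U" for U
  proof (rule ccontr)
    assume proper: "\<not> ?thesis"
    have "sym_diff X U = X - U" using U(1) by blast
    then have "X - U \<in> cycles"
      using even_set_sym_diff[OF X'(4) U(2)] U(1) X'(1) proper by (intro cyclesI) auto
    moreover have "U \<in> cycles" using U X'(1) proper by (intro cyclesI) auto
    ultimately show False using cycles_cross by blast
  qed
  then show ?thesis using X'(7) by (simp add: simple_cycle_def)
qed

lemma triple_cycles:
  assumes "triple X Y Z"
  shows "X \<in> cycles" "Y \<in> cycles" "Z \<in> cycles" "X \<noteq> Y" "X \<noteq> Z" "Y \<noteq> Z"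
proof -
  show XY: "X \<in> cycles" "Y \<in> cycles" "X \<noteq> Y" using assms by (simp_all add: triple_def)
  have Z: "Z = sym_diff X Y" using assms by (simp add: triple_def)
  show "Z \<in> cycles"
    unfolding Z using XY cyclesD(1,4)[OF XY(1)] cyclesD(1,4)[OF XY(2)]
    by (intro cyclesI even_set_sym_diff) auto
  show "X \<noteq> Z" "Y \<noteq> Z" using cyclesD(3)[OF XY(1)] cyclesD(3)[OF XY(2)] Z by auto
qed

lemma exists_triple: "\<exists>X Y Z. triple X Y Z"
  using bicyclic_S unfolding bicyclic_def triple_def by (metis cyclesI)

lemma exists_triple_with:
  assumes "X \<in> cycles"
  shows "\<exists>Y Z. triple X Y Z"
proof -
  obtain Y where "Y \<in> cycles" "X \<noteq> Y" using exists_triple triple_cycles by metis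
  then show ?thesis using assms by (auto simp: triple_def)
qed

lemma triple_Un:
  assumes "triple X Y Z"
  shows "X \<union> Y = S"
proof (rule card_seteq[OF finite_S])
  note X = cyclesD[OF triple_cycles(1)[OF assms]] and Y = cyclesD[OF triple_cycles(2)[OF assms]]
  show sub: "X \<union> Y \<subseteq> S" using X(1) Y(1) by blast
  have "bicyclic en (X \<union> Y)"
    unfolding bicyclic_def using X Y triple_cycles(4)[OF assms]
    by (intro exI[of _ X] exI[of _ Y]) simp
  then show "card S \<le> card (X \<union> Y)"
    by (intro least inj_on_subset[OF inj_on_S sub] subset_trans[OF sub S_subset])
qed

lemma triple_multiplicity:
  assumes "triple X Y Z"
  shows "of_bool (e \<in> X) + of_bool (e \<in> Y) + of_bool (e \<in> Z) = (if e \<in> S then 2 else (0 :: nat))"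
  using assms triple_Un[OF assms] by (auto simp: triple_def)

lemma card_triple:
  assumes "triple X Y Z"
  shows "card X + card Y + card Z = 2 * card S"
  using assms card_add_card_sym_diff[of X Y] triple_Un[OF assms] cyclesD(5)
  by (simp add: triple_def)

lemma degree_triple:
  assumes "triple X Y Z"
  shows "degree en X v + degree en Y v + degree en Z v = 2 * degree en S v"
proof -
  let ?C = "cut en {v}"
  have "Z \<inter> ?C = sym_diff (X \<inter> ?C) (Y \<inter> ?C)" using assms by (auto simp: triple_def)
  moreover have "S \<inter> ?C = X \<inter> ?C \<union> Y \<inter> ?C" using triple_Un[OF assms] by blast
  ultimately show ?thesis
    using card_add_card_sym_diff[of "X \<inter> ?C" "Y \<inter> ?C"] triple_cycles[OF assms] cyclesD(5)
    by (simp add: degree_def)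
qed

lemma degree_S_eq_supports:
  assumes "triple X Y Z"
  shows "degree en S v =
    of_bool (v \<in> support en X) + of_bool (v \<in> support en Y) + of_bool (v \<in> support en Z)"
  using degree_triple[OF assms, of v] triple_cycles(1-3)[OF assms]
  by (simp add: degree_simple_cycle simple_cycle_if_cycles split: if_splits)

lemma degree_S_le: "degree en S v \<le> 3"
  using exists_triple degree_S_eq_supports by (fastforce simp: of_bool_def split: if_splits)

lemma two_le_degree_S:
  assumes "v \<in> VS"
  shows "2 \<le> degree en S v"
proof -
  obtain X Y Z where triple: "triple X Y Z" using exists_triple by blast
  obtain W where W: "W \<in> {X, Y}" "v \<in> support en W"
    using assms triple_Un[OF triple] by (auto simp: support_def)
  then have "W \<in> cycles" using triple_cycles[OF triple] by auto
  then have "2 \<le> degree en W v" "W \<subseteq> S"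
    using degree_simple_cycle[OF simple_cycle_if_cycles] W(2) cyclesD(1) by auto
  then show ?thesis using degree_mono[OF _ S_subset, of W v] by simp
qed

lemma card_le_if_smaller:
  "Q \<subseteq> E \<Longrightarrow> inj_on c Q \<Longrightarrow> card Q < card S \<Longrightarrow> support en Q \<subseteq> W \<Longrightarrow> finite W \<Longrightarrow> card Q \<le> card W"
  using least[of Q] bicyclic_if_card_support_less[of Q W] by force

lemma not_all_degrees_two: "\<exists>v\<in>VS. degree en S v \<noteq> 2"
proof (rule ccontr)
  assume two: "\<not> ?thesis"
  obtain X Y Z where triple: "triple X Y Z" using exists_triple by blast
  note cycles = triple_cycles[OF triple]
  note X = cyclesD[OF cycles(1)] and Y = cyclesD[OF cycles(2)]
  have "even (degree en (X \<inter> Y) v)" for v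
  proof -
    have "(X \<inter> Y) \<inter> cut en {v} = (X \<inter> cut en {v}) \<inter> (Y \<inter> cut en {v})"
      and "S \<inter> cut en {v} = (X \<inter> cut en {v}) \<union> (Y \<inter> cut en {v})"
      using triple_Un[OF triple] by blast+
    then have "degree en X v + degree en Y v = degree en S v + degree en (X \<inter> Y) v"
      using card_Un_Int[of "X \<inter> cut en {v}" "Y \<inter> cut en {v}"] X(5) Y(5) by (simp add: degree_def)
    moreover have "even (degree en S v)"
      using two degree_pos_iff[OF S_subset, of v] by (cases "v \<in> VS") auto
    ultimately show ?thesis using X(4) Y(4) unfolding even_set_def by (metis even_add)
  qed
  then have "even_set en (X \<inter> Y)" using X(5) by (simp add: even_set_def)
  moreover have "X \<inter> Y \<noteq> {}" by (rule cycles_cross[OF cycles(1,2)])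
  ultimately have "X \<inter> Y = X" "X \<inter> Y = Y"
    using simple_cycle_minimal[OF simple_cycle_if_cycles] cycles(1,2)
    by (metis inf_le1, metis inf_le2)
  then show False using cycles(4) by auto
qed

lemma card_S: "card S = card VS + 1"
proof (rule antisym)
  obtain X Y where "X \<in> cycles" using exists_triple triple_cycles by blast
  then obtain e where e: "e \<in> S" using cyclesD(1,3) by blast
  have smaller: "card (S - {e}) < card S" using finite_S e by (rule card_Diff1_less)
  have "support en (S - {e}) \<subseteq> VS" "S - {e} \<subseteq> E" using S_subset by (auto simp: support_def)
  then have "card (S - {e}) \<le> card VS"
    using smaller inj_on_S finite_VS by (intro card_le_if_smaller) (auto intro: inj_on_subset)
  then show "card S \<le> card VS + 1" using e finite_S by simp
  obtain v where "v \<in> VS" "degree en S v \<noteq> 2" using not_all_degrees_two by blast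
  then have "(\<Sum>v\<in>VS. 2) < (\<Sum>v\<in>VS. degree en S v)"
    using two_le_degree_S
    by (intro sum_strict_mono_ex1[OF finite_VS])
      (auto intro!: bexI[of _ v] simp: le_neq_implies_less)
  then show "card VS + 1 \<le> card S" using sum_degree[OF S_subset subset_refl finite_VS] by simp
qed

lemma card_degree_three: "card {v\<in>VS. degree en S v = 3} = 2"
proof -
  have "degree en S v = 2 + of_bool (degree en S v = 3)" if "v \<in> VS" for v
    using degree_S_le[of v] two_le_degree_S[OF that] by auto
  then have "(\<Sum>v\<in>VS. degree en S v) = (\<Sum>v\<in>VS. 2 + of_bool (degree en S v = 3))"
    by (rule sum.cong[OF refl])
  also have "\<dots> = 2 * card VS + card {v\<in>VS. degree en S v = 3}"
    unfolding sum.distrib using finite_VS by (simp add: of_bool_def sum.If_cases Int_def)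
  finally show ?thesis using sum_degree[OF S_subset subset_refl finite_VS] card_S by simp
qed

lemma cycle_through_two_vertices:
  assumes "a \<in> VS" "b \<in> VS"
  shows "\<exists>X\<in>cycles. a \<in> support en X \<and> b \<in> support en X"
proof -
  obtain X Y Z where triple: "triple X Y Z" using exists_triple by blast
  show ?thesis
    using two_le_degree_S[OF assms(1)] two_le_degree_S[OF assms(2)] triple_cycles(1-3)[OF triple]
    unfolding degree_S_eq_supports[OF triple] by (auto simp: of_bool_def split: if_splits)
qed

lemma another_cycle_through_branch_vertex:
  assumes "degree en S a = 3" "b \<in> VS" "X \<in> cycles"
  shows "\<exists>W\<in>cycles. W \<noteq> X \<and> a \<in> support en W \<and> b \<in> support en W"
proof -
  obtain Y Z where triple: "triple X Y Z" using exists_triple_with[OF assms(3)] by blast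
  note supports = degree_S_eq_supports[OF triple]
  have "a \<in> support en Y" "a \<in> support en Z"
    using assms(1) unfolding supports by (auto simp: of_bool_def split: if_splits)
  moreover have "b \<in> support en Y \<or> b \<in> support en Z"
    using two_le_degree_S[OF assms(2)] unfolding supports
    by (auto simp: of_bool_def split: if_splits)
  ultimately show ?thesis using triple_cycles[OF triple] by blast
qed

subsection \<open>Exchanging edges for their partners\<close>

lemma card_rainbow_avoiding_vertex:
  assumes Q: "Q \<subseteq> E" "inj_on c Q" "support en Q \<subseteq> VS - {v}" and v: "v \<in> VS"
  shows "card Q < card VS"
proof (rule ccontr)
  assume "\<not> ?thesis"
  then obtain Q' where Q': "Q' \<subseteq> Q" "card Q' = card VS"
    using obtain_subset_with_card_n[of "card VS" Q] by auto
  have "support en Q' \<subseteq> VS - {v}" using support_mono[OF Q'(1)] Q(3) by (rule subset_trans)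
  then have "card Q' \<le> card (VS - {v})"
    using Q' Q(1,2) inj_on_subset card_S finite_VS by (intro card_le_if_smaller) auto
  then show False using Q'(2) card_Diff1_less[OF finite_VS v] by simp
qed

lemma partner_notin_S: "z \<in> S \<Longrightarrow> partner z \<notin> S"
  using inj_on_S S_subset colour_partner colour_class_eq(2) by (metis inj_onD subsetD)

lemma inj_on_if_partner_notin:
  assumes "A \<subseteq> E" and avoid: "\<And>e. e \<in> A \<Longrightarrow> e \<notin> S \<Longrightarrow> partner e \<notin> A"
  shows "inj_on c A"
proof (rule inj_onI, rule ccontr)
  fix e f assume ef: "e \<in> A" "f \<in> A" "c e = c f" "e \<noteq> f"
  have "f = partner e" "e = partner f"
    using same_colourD[of e f] same_colourD[of f e] ef assms(1) by auto
  then have "partner e \<in> A" "partner f \<in> A" using ef(1,2) by simp_all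
  then have "e \<in> S" "f \<in> S" using avoid ef(1,2) by blast+
  then show False using inj_on_S ef(3,4) by (auto dest: inj_onD)
qed

lemma three_le_degree_insert:
  assumes e: "e \<in> E" "c e \<notin> c ` S" "en e \<subseteq> VS" and v: "v \<in> VS"
  shows "3 \<le> degree en (insert e S) v"
proof -
  let ?Q = "insert e S"
  have QE: "?Q \<subseteq> E" and inj: "inj_on c ?Q" using e S_subset inj_on_S by (auto simp: inj_on_insert)
  have fin: "finite ?Q" using finite_S by simp
  let ?Q' = "?Q - {g\<in>?Q. v \<in> en g}"
  have card_Q': "card ?Q' = card ?Q - degree en ?Q v"
    using fin by (simp only: degree_eq[OF QE]) (rule card_Diff_subset, auto)
  have "support en ?Q' \<subseteq> VS - {v}" using e(3) by (auto simp: support_def)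
  then have "card ?Q' < card VS"
    using QE inj v by (intro card_rainbow_avoiding_vertex) (auto intro: inj_on_subset)
  moreover have "card ?Q = card VS + 2"
    using e(2) finite_S card_S by (subst card_insert_disjoint) auto
  ultimately show ?thesis using card_Q' by linarith
qed

text \<open>Otherwise \<open>insert e S\<close> is a graph of minimum degree three with two more edges than vertices,
  hence complete on four vertices, which leaves no room for the partner of \<open>e\<close>.\<close>

lemma colour_leaves_support:
  assumes e: "e \<in> E" "c e \<notin> c ` S"
  shows "\<not> (en e \<subseteq> VS \<and> en (partner e) \<subseteq> VS)"
proof
  assume inside: "en e \<subseteq> VS \<and> en (partner e) \<subseteq> VS"
  let ?Q = "insert e S" and ?Q' = "insert (partner e) (insert e S)"
  have Q'E: "?Q' \<subseteq> E" using e(1) S_subset partner_in_E by auto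
  have notin: "e \<notin> S" "partner e \<notin> insert e S"
    using e colour_partner colour_class_eq(2)[OF e(1)] by (metis imageI, metis imageI insertE)
  have support: "support en ?Q \<subseteq> VS" "support en ?Q' \<subseteq> VS" using inside by (auto simp: support_def)
  have "(\<Sum>v\<in>VS. 3) \<le> (\<Sum>v\<in>VS. degree en ?Q v)"
    using e inside by (intro sum_mono three_le_degree_insert) auto
  then have "3 * card VS \<le> 2 * (card VS + 2)"
    using sum_degree[of ?Q VS] Q'E support(1) finite_VS finite_S notin card_S by simp
  then have "card VS \<le> 4" by simp
  then have "card VS = 0 \<or> card VS = 1 \<or> card VS = 2 \<or> card VS = 3 \<or> card VS = 4" by linarith
  moreover have "card VS + 3 \<le> card VS choose 2"
  proof -
    have "card VS + 3 = card (en ` ?Q')"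
      using notin finite_S card_S card_image[OF inj_on_subset[OF inj_ends Q'E]] by simp
    also have "\<dots> \<le> card {B. B \<subseteq> VS \<and> card B = 2}"
    proof (intro card_mono image_subsetI CollectI conjI)
      fix g assume "g \<in> ?Q'"
      then show "en g \<subseteq> VS" "card (en g) = 2"
        using support(2) ends_subset_support[of g ?Q' en] card_ends Q'E by blast+
    qed (use finite_VS in simp)
    also have "\<dots> = card VS choose 2" using n_subsets[OF finite_VS] .
    finally show ?thesis .
  qed
  ultimately show False by (auto simp: choose_two)
qed

definition exchangeable :: "'a \<Rightarrow> 'b set" where
  "exchangeable v = {z\<in>S. v \<in> en z \<and> en (partner z) \<subseteq> VS - {v}}"

text \<open>If all but one edge at \<open>v\<close> could be exchanged for chords avoiding \<open>v\<close>, this would give a smaller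
  bicyclic rainbow set.\<close>

lemma card_exchangeable:
  assumes v: "v \<in> VS"
  shows "card (exchangeable v) + 2 \<le> degree en S v"
proof -
  let ?J = "exchangeable v" and ?at = "{z\<in>S. v \<in> en z}"
  let ?Q = "(S - ?at) \<union> partner ` ?J"
  have J: "?J \<subseteq> S" "?J \<subseteq> ?at" by (auto simp: exchangeable_def)
  then have JE: "?J \<subseteq> E" using S_subset by blast
  have fin: "finite ?J" using J(1) finite_S by (rule finite_subset)
  have QE: "?Q \<subseteq> E" using S_subset JE partner_in_E by blast
  have "inj_on c ?Q"
  proof (rule inj_on_if_partner_notin[OF QE])
    fix e assume "e \<in> ?Q" "e \<notin> S"
    then obtain z where z: "z \<in> ?J" "partner e = z" using partner_partner JE by blast
    moreover have "z \<notin> partner ` ?J" using z(1) J(1) partner_notin_S by blast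
    ultimately show "partner e \<notin> ?Q" using J(2) by auto
  qed
  moreover have "support en ?Q \<subseteq> VS - {v}" by (auto simp: support_def exchangeable_def)
  ultimately have "card ?Q < card VS" using v by (rule card_rainbow_avoiding_vertex[OF QE])
  moreover have "card ?Q = card (S - ?at) + card ?J"
  proof -
    have "inj_on partner ?J"
      by (rule inj_on_inverseI[of _ partner]) (use partner_partner JE in blast)
    moreover have "(S - ?at) \<inter> partner ` ?J = {}" using J(1) partner_notin_S by blast
    ultimately show ?thesis using fin finite_S by (simp add: card_Un_disjoint card_image)
  qed
  moreover have "card (S - ?at) = card S - degree en S v" "degree en S v \<le> card S"
    using finite_S by (auto simp: degree_eq[OF S_subset] card_Diff_subset intro: card_mono)
  ultimately show ?thesis using card_S by linarith
qed

lemma exchangeableD: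
  assumes z: "z \<in> exchangeable v"
  shows "v \<in> VS" "degree en S v = 3" "exchangeable v = {z}"
proof -
  show v: "v \<in> VS" using z by (auto simp: exchangeable_def support_def)
  have "finite (exchangeable v)" using finite_S by (simp add: exchangeable_def)
  then have "0 < card (exchangeable v)" using z card_gt_0_iff by blast
  then have "degree en S v = 3" "card (exchangeable v) = 1"
    using card_exchangeable[OF v] degree_S_le[of v] by linarith+
  then show "degree en S v = 3" "exchangeable v = {z}" using z by (auto simp: card_1_singleton_iff)
qed

lemma exchangeable_if_chord:
  assumes z: "z \<in> S" "en (partner z) \<subseteq> VS"
  shows "\<exists>v. z \<in> exchangeable v"
proof -
  have zE: "z \<in> E" "partner z \<in> E" using z S_subset partner_in_E by auto
  have "en z \<noteq> en (partner z)" using ends_eqD[OF zE] colour_class_eq(2)[OF zE(1)] by auto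
  then have "\<not> en z \<subseteq> en (partner z)"
    using card_seteq[of "en (partner z)" "en z"] card_ends[OF zE(1)] card_ends[OF zE(2)]
    by (metis card.infinite order_refl zero_neq_numeral)
  then show ?thesis using z by (auto simp: exchangeable_def)
qed

lemma rainbow_cycle_outside:
  "\<exists>C. simple_cycle C \<and> inj_on c C \<and> C \<inter> S = {} \<and> (\<forall>h\<in>C. en h \<subseteq> VS \<longrightarrow> partner h \<in> S)"
proof -
  let ?P = "\<lambda>e. e \<notin> S \<and> (en e \<subseteq> VS \<longrightarrow> partner e \<in> S)"
  have "\<exists>e\<in>E. c e = s \<and> ?P e" if s: "s \<in> {1..m}" for s
  proof (cases "s \<in> c ` S")
    case True
    then obtain z where z: "z \<in> S" "s = c z" by blast
    then have "z \<in> E" using S_subset by auto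
    then show ?thesis
      using z partner_in_E colour_partner partner_partner partner_notin_S
      by (intro bexI[of _ "partner z"]) auto
  next
    case False
    have "{e\<in>E. c e = s} \<noteq> {}" using card_colour_class[OF s] by (metis card.empty zero_neq_numeral)
    then obtain e where e: "e \<in> E" "c e = s" by blast
    have notin: "e \<notin> S" "partner e \<notin> S" using e False colour_partner[OF e(1)] by (metis imageI)+
    have "\<not> (en e \<subseteq> VS \<and> en (partner e) \<subseteq> VS)"
      using colour_leaves_support[OF e(1)] e(2) False by blast
    then consider "\<not> en e \<subseteq> VS" | "\<not> en (partner e) \<subseteq> VS" by blast
    then show ?thesis using e notin partner_in_E[OF e(1)] colour_partner[OF e(1)] by cases auto
  qed
  then obtain R where R: "R \<subseteq> E" "inj_on c R" "card R = m" "\<forall>e\<in>R. ?P e"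
    using rainbow_transversal[of ?P] by blast
  have "0 < card R" using card_rainbow_le[OF S_subset inj_on_S] card_S R(3) by linarith
  then have "R \<noteq> {}" by auto
  then have "\<exists>T\<subseteq>R. T \<noteq> {} \<and> even_set en T"
    using R(1,3) card_V_le finite_V support_subset_V
    by (intro exists_even_subset_if_card_support_le[of R V]) auto
  then obtain T where "T \<subseteq> R" "cyclic T" using R(1) by (auto simp: cyclic_def)
  then obtain C where C: "C \<subseteq> R" "simple_cycle C" using exists_simple_cycle_subset[of T] by blast
  have "inj_on c C" using R(2) C(1) by (rule inj_on_subset)
  then show ?thesis using C R(4) by blast
qed

end

subsection \<open>The fourth cycle\<close>

lemma (in rainbow_theta) rainbow_4_tuple_if_modified_triple:
  assumes triple: "triple X Y Z" and C: "cyclic C" "inj_on c C" "C \<inter> S = {}"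
    and cyclic: "\<And>A. A \<in> {X', Y', Z'} \<Longrightarrow> cyclic A \<and> inj_on c A"
    and new: "X' \<subseteq> X \<union> H" "Y' \<subseteq> Y \<union> H" "Z' \<subseteq> Z \<union> H"
    and once: "\<And>h. h \<in> H \<Longrightarrow> of_bool (h \<in> X') + of_bool (h \<in> Y') + of_bool (h \<in> Z') \<le> (1 :: nat)"
    and cards: "card X' + card Y' + card Z' + card C \<le> 2 * m + 2"
  shows "rainbow_4_tuple cyclic c (2 * m + 2) [X', Y', Z', C]"
proof -
  have "of_bool (e \<in> X') + of_bool (e \<in> Y') + of_bool (e \<in> Z') + of_bool (e \<in> C) \<le> (2 :: nat)" for e
  proof (cases "e \<in> H")
    case True
    then show ?thesis using once[OF True] by simp
  next
    case False
    then have "e \<in> X' \<Longrightarrow> e \<in> X" "e \<in> Y' \<Longrightarrow> e \<in> Y" "e \<in> Z' \<Longrightarrow> e \<in> Z" using new by auto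
    moreover have "e \<in> S \<Longrightarrow> e \<notin> C" using C(3) by auto
    ultimately show ?thesis
      using triple_multiplicity[OF triple, of e] by (auto simp: of_bool_def split: if_splits)
  qed
  then show ?thesis using cyclic C(1,2) cards by (auto simp: rainbow_4_tuple_def add.assoc)
qed

locale rainbow_theta_with_cycle = rainbow_theta +
  fixes C
  assumes simple_C: "simple_cycle C" and inj_on_C: "inj_on c C" and C_disjoint: "C \<inter> S = {}"
    and partner_chord_in_S: "h \<in> C \<Longrightarrow> en h \<subseteq> VS \<Longrightarrow> partner h \<in> S"
begin

definition chords :: "'b set" where
  "chords = {h\<in>C. en h \<subseteq> VS}"

lemma chordsD:
  assumes "h \<in> chords"
  shows "h \<in> E" "h \<notin> S" "en h \<subseteq> VS" "partner h \<in> S" "partner (partner h) = h"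
proof -
  show h: "h \<in> E" "h \<notin> S" "en h \<subseteq> VS" "partner h \<in> S"
    using assms simple_cycleD(1)[OF simple_C] C_disjoint partner_chord_in_S
    by (auto simp: chords_def)
  show "partner (partner h) = h" by (rule partner_partner[OF h(1)])
qed

lemma finite_chords: "finite chords"
  using finite_edges[OF simple_cycleD(1)[OF simple_C]] by (simp add: chords_def)

lemma chord_notin_cycle: "h \<in> chords \<Longrightarrow> X \<in> cycles \<Longrightarrow> h \<notin> X"
  using chordsD(2) cyclesD(1) by blast

definition apex :: "'b \<Rightarrow> 'a" where
  "apex h = (SOME v. partner h \<in> exchangeable v)"

lemma partner_exchangeable_apex:
  assumes "h \<in> chords"
  shows "partner h \<in> exchangeable (apex h)"
proof -
  have "\<exists>v. partner h \<in> exchangeable v"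
    using exchangeable_if_chord[of "partner h"] chordsD[OF assms] by simp
  then show ?thesis unfolding apex_def by (rule someI_ex)
qed

lemma apex:
  assumes "h \<in> chords"
  shows "apex h \<in> VS" "degree en S (apex h) = 3" "apex h \<in> en (partner h)" "apex h \<notin> en h"
proof -
  note exchangeable = partner_exchangeable_apex[OF assms]
  show "apex h \<in> VS" "degree en S (apex h) = 3" using exchangeableD(1,2)[OF exchangeable] .
  show "apex h \<in> en (partner h)" "apex h \<notin> en h"
    using exchangeable chordsD(5)[OF assms] by (auto simp: exchangeable_def)
qed

lemma inj_on_apex: "inj_on apex chords"
proof (rule inj_onI)
  fix h k assume hk: "h \<in> chords" "k \<in> chords" "apex h = apex k"
  have "partner h \<in> exchangeable (apex h)" "partner k \<in> exchangeable (apex h)"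
    using partner_exchangeable_apex hk by metis+
  then have "partner h = partner k" using exchangeableD(3) by blast
  then show "h = k" using chordsD(5) hk(1,2) by metis
qed

lemma card_chords_le: "card chords \<le> 2"
proof -
  have "card chords \<le> card {v\<in>VS. degree en S v = 3}"
    using inj_on_apex apex finite_VS by (intro card_inj_on_le) auto
  then show ?thesis by (simp add: card_degree_three)
qed

lemma two_card_S_add_card_C_le: "2 * card S + card C \<le> 2 * m + 2 + card chords"
proof -
  have "VS \<subseteq> V" by (rule support_subset_V[OF S_subset])
  then have "card (V - VS) = card V - card VS" "card VS \<le> card V"
    using finite_VS finite_V by (auto simp: card_Diff_subset card_mono)
  then have "card (V - VS) + card VS \<le> m" using card_V_le by linarith
  moreover have "card C \<le> 2 * card (V - VS) + card chords"
    unfolding chords_def by (rule card_simple_cycle_le[OF simple_C])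
  ultimately show ?thesis using card_S by linarith
qed

lemma cycle_through_chord_ends:
  assumes "h \<in> chords"
  shows "\<exists>X\<in>cycles. en h \<subseteq> support en X"
proof -
  obtain a b where "en h = {a, b}"
    using is_edge_ends[OF chordsD(1)[OF assms]] by (auto simp: is_edge_def)
  then show ?thesis using cycle_through_two_vertices[of a b] chordsD(3)[OF assms] by auto
qed

lemma rainbow_4_tuple_if_modified_cycles:
  assumes triple: "triple X Y Z"
    and cyclic: "\<And>A. A \<in> {X', Y', Z'} \<Longrightarrow> cyclic A \<and> inj_on c A"
    and new: "X' \<subseteq> X \<union> chords" "Y' \<subseteq> Y \<union> chords" "Z' \<subseteq> Z \<union> chords"
    and once: "\<And>h. h \<in> chords \<Longrightarrow> of_bool (h \<in> X') + of_bool (h \<in> Y') + of_bool (h \<in> Z') \<le> (1 :: nat)"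
    and cards: "card X' + card Y' + card Z' + card chords \<le> 2 * card S"
  shows "\<exists>As. rainbow_4_tuple cyclic c (2 * m + 2) As"
proof -
  have "rainbow_4_tuple cyclic c (2 * m + 2) [X', Y', Z', C]"
  proof (rule rainbow_4_tuple_if_modified_triple[OF triple _ inj_on_C C_disjoint cyclic new once])
    show "cyclic C" using simple_C by (simp add: simple_cycle_def)
    show "card X' + card Y' + card Z' + card C \<le> 2 * m + 2"
      using cards two_card_S_add_card_C_le by linarith
  qed
  then show ?thesis by blast
qed

text \<open>The chord cuts the cycle \<open>X\<close> into two cycles, both rainbow because they avoid the partner of
  the chord; with the other two cycles they cover \<open>insert h S\<close> twice.\<close>

lemma rainbow_4_tuple_if_free_chord:
  assumes X: "X \<in> cycles" and h: "h \<in> chords" "en h \<subseteq> support en X" "partner h \<notin> X"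
  shows "\<exists>As. rainbow_4_tuple cyclic c (2 * m + 2) As"
proof -
  note X' = cyclesD[OF X] and hX = chord_notin_cycle[OF h(1) X] and hE = chordsD(1)[OF h(1)]
  obtain Y Z where triple: "triple X Y Z" using exists_triple_with[OF X] by blast
  obtain z where "z \<in> X" using X'(3) by blast
  then obtain T where T: "T \<subseteq> insert h X" "even_set en T" "h \<in> T"
    using exists_cycle_through_chord[OF simple_cycle_if_cycles[OF X] hE hX h(2)] by blast
  let ?T' = "sym_diff X T"
  have even: "even_set en ?T'" using X'(4) T(2) by (rule even_set_sym_diff)
  have sub: "insert h X \<subseteq> E" using hE X'(2) by blast
  have avoids: "inj_on c A" if "A \<subseteq> insert h X" for A
  proof (rule inj_on_if_partner_notin)
    fix e assume "e \<in> A" "e \<notin> S"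
    then have "e = h" using that X'(1) by blast
    then show "partner e \<notin> A" using that h(3) colour_class_eq(2)[OF hE] by blast
  qed (use that sub in blast)
  have "cyclic T" "cyclic ?T'" using T hX sub even by (auto simp: cyclic_def)
  moreover have "inj_on c T" "inj_on c ?T'" using T(1) by (auto intro!: avoids)
  moreover have "card T + card ?T' + card Y + card Z \<le> 2 * m + 2"
    using card_sym_diff_add_card[OF X'(5) hX T(3,1)] card_triple[OF triple]
      card_rainbow_le[OF S_subset inj_on_S] by linarith
  moreover have
    "of_bool (e \<in> T) + of_bool (e \<in> ?T') + of_bool (e \<in> Y) + of_bool (e \<in> Z) \<le> (2 :: nat)" for e
    using triple_multiplicity[OF triple, of e] T(1) hX chordsD(2)[OF h(1)]
    by (auto simp: of_bool_def split: if_splits)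
  ultimately have "rainbow_4_tuple cyclic c (2 * m + 2) [T, ?T', Y, Z]"
    using triple_cycles[OF triple] cyclesD(6,7) by (auto simp: rainbow_4_tuple_def add.assoc)
  then show ?thesis by blast
qed

end

locale rainbow_theta_without_free_chord = rainbow_theta_with_cycle +
  assumes partner_in_cycle: "X \<in> cycles \<Longrightarrow> h \<in> chords \<Longrightarrow> en h \<subseteq> support en X \<Longrightarrow> partner h \<in> X"
begin

text \<open>The sum of \<open>X\<close> and \<open>T\<close> is a shorter cycle that contains the chord \<open>h\<close> but not its partner.\<close>

definition shortcut :: "'b set \<Rightarrow> 'b \<Rightarrow> 'b set \<Rightarrow> bool" where
  "shortcut X h T \<longleftrightarrow> X \<in> cycles \<and> h \<in> chords \<and> T \<subseteq> insert h X \<and> even_set en T \<and> h \<in> T \<and> partner h \<in> T"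

lemma exists_shortcut:
  assumes "X \<in> cycles" "h \<in> chords" "en h \<subseteq> support en X"
  shows "\<exists>T. shortcut X h T"
  using exists_cycle_through_chord[OF simple_cycle_if_cycles[OF assms(1)] chordsD(1)[OF assms(2)]
      chord_notin_cycle[OF assms(2,1)] assms(3) partner_in_cycle[OF assms]] assms(1,2)
  by (auto simp: shortcut_def)

lemma shortcutD:
  assumes "shortcut X h T"
  shows "X \<in> cycles" "h \<in> chords" "T \<subseteq> insert h X" "T \<subseteq> E" "even_set en T" "h \<in> T" "partner h \<in> T"
    "h \<notin> X"
proof -
  show X: "X \<in> cycles" and h: "h \<in> chords"
    and T: "T \<subseteq> insert h X" "even_set en T" "h \<in> T" "partner h \<in> T"
    using assms by (simp_all add: shortcut_def)
  show "T \<subseteq> E" using T(1) cyclesD(2)[OF X] chordsD(1)[OF h] by blast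
  show "h \<notin> X" by (rule chord_notin_cycle[OF h X])
qed

lemma partner_in_shortcut_cycle: "shortcut X h T \<Longrightarrow> partner h \<in> X"
  using shortcutD(2,3,7) chordsD(2,4) by (metis insertE subsetD)

lemma three_le_card_shortcut:
  assumes "shortcut X h T"
  shows "3 \<le> card T"
  using shortcutD(4-6)[OF assms] by (intro three_le_card_even_set) auto

lemma shortened_cycle:
  assumes "shortcut X h T"
  shows "cyclic (sym_diff X T)" "inj_on c (sym_diff X T)" "sym_diff X T \<subseteq> insert h X"
    "card (sym_diff X T) + card T = card X + 2"
proof -
  note T = shortcutD[OF assms] and X = cyclesD[OF shortcutD(1)[OF assms]]
  have sub: "sym_diff X T \<subseteq> E" "h \<in> sym_diff X T" using T X(2) by auto
  then show "cyclic (sym_diff X T)"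
    using even_set_sym_diff[OF X(4) T(5)] by (auto simp: cyclic_def)
  show new: "sym_diff X T \<subseteq> insert h X" using T(3) by blast
  have "partner h \<notin> sym_diff X T" using T(7) partner_in_shortcut_cycle[OF assms] by blast
  then show "inj_on c (sym_diff X T)"
    using new X(1) by (intro inj_on_if_partner_notin[OF sub(1)]) blast
  show "card (sym_diff X T) + card T = card X + 2"
    by (rule card_sym_diff_add_card[OF X(5) T(8,6,3)])
qed

lemma rainbow_4_tuple_if_long_shortcut:
  assumes shortcut: "shortcut X h T" and long: "card chords + 2 \<le> card T"
  shows "\<exists>As. rainbow_4_tuple cyclic c (2 * m + 2) As"
proof -
  note T = shortcutD[OF shortcut] and X' = shortened_cycle[OF shortcut]
  obtain Y Z where triple: "triple X Y Z" using exists_triple_with[OF T(1)] by blast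
  show ?thesis
  proof (rule rainbow_4_tuple_if_modified_cycles[OF triple, of "sym_diff X T" Y Z])
    show "cyclic A \<and> inj_on c A" if "A \<in> {sym_diff X T, Y, Z}" for A
      using that X'(1,2) triple_cycles[OF triple] cyclesD(6,7) by blast
    show "of_bool (k \<in> sym_diff X T) + of_bool (k \<in> Y) + of_bool (k \<in> Z) \<le> (1 :: nat)"
      if "k \<in> chords" for k
      using chord_notin_cycle[OF that] triple_cycles[OF triple] by simp
    show "card (sym_diff X T) + card Y + card Z + card chords \<le> 2 * card S"
      using card_triple[OF triple] X'(4) long by linarith
  qed (use X'(3) T(2) in auto)
qed

lemma rainbow_4_tuple_if_shortcuts_of_different_cycles:
  assumes T: "shortcut X h T" and U: "shortcut W k U" and "X \<noteq> W" "h \<noteq> k" "card chords = 2"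
  shows "\<exists>As. rainbow_4_tuple cyclic c (2 * m + 2) As"
proof -
  define Z where "Z = sym_diff X W"
  have triple: "triple X W Z"
    using shortcutD(1)[OF T] shortcutD(1)[OF U] \<open>X \<noteq> W\<close> by (simp add: triple_def Z_def)
  note X' = shortened_cycle[OF T] and W' = shortened_cycle[OF U]
  show ?thesis
  proof (rule rainbow_4_tuple_if_modified_cycles[OF triple, of "sym_diff X T" "sym_diff W U" Z])
    show "cyclic A \<and> inj_on c A" if "A \<in> {sym_diff X T, sym_diff W U, Z}" for A
      using that X'(1,2) W'(1,2) triple_cycles[OF triple] cyclesD(6,7) by blast
    show "of_bool (g \<in> sym_diff X T) + of_bool (g \<in> sym_diff W U) + of_bool (g \<in> Z) \<le> (1 :: nat)"
      if "g \<in> chords" for g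
    proof -
      have "g \<notin> X" "g \<notin> W" "g \<notin> Z" using chord_notin_cycle[OF that] triple_cycles[OF triple] by auto
      then have "\<not> (g \<in> sym_diff X T \<and> g \<in> sym_diff W U)" using X'(3) W'(3) \<open>h \<noteq> k\<close> by blast
      then show ?thesis using \<open>g \<notin> Z\<close> by (auto simp: of_bool_def)
    qed
    show "card (sym_diff X T) + card (sym_diff W U) + card Z + card chords \<le> 2 * card S"
      using card_triple[OF triple] X'(4) W'(4) three_le_card_shortcut[OF T]
        three_le_card_shortcut[OF U]
        \<open>card chords = 2\<close> by linarith
  qed (use X'(3) W'(3) shortcutD(2)[OF T] shortcutD(2)[OF U] in auto)
qed

lemma twice_shortened_cycle:
  assumes T: "shortcut X h T" and U: "shortcut X k U" and "h \<noteq> k" "T \<inter> U = {}"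
  defines "X' \<equiv> sym_diff (sym_diff X T) U"
  shows "cyclic X'" "inj_on c X'" "X' \<subseteq> X \<union> {h, k}" "card X' + card T + card U = card X + 4"
proof -
  note T' = shortcutD[OF T] and U' = shortcutD[OF U] and X = cyclesD[OF shortcutD(1)[OF T]]
  show sub: "X' \<subseteq> X \<union> {h, k}" using T'(3) U'(3) by (auto simp: X'_def)
  have "h \<in> X'" using T'(6,8) assms(4) by (auto simp: X'_def)
  moreover have subE: "X' \<subseteq> E" using sub X(2) chordsD(1) T'(2) U'(2) by blast
  moreover have "even_set en X'" unfolding X'_def by (intro even_set_sym_diff X(4) T'(5) U'(5))
  ultimately show "cyclic X'" by (auto simp: cyclic_def)
  have "partner h \<notin> X'" "partner k \<notin> X'"
    using T'(7) U'(7) partner_in_shortcut_cycle[OF T] partner_in_shortcut_cycle[OF U] assms(4)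
    by (auto simp: X'_def)
  then show "inj_on c X'" using sub X(1) by (intro inj_on_if_partner_notin[OF subE]) blast
  have "card X' + card U = card (sym_diff X T) + 2"
    unfolding X'_def
  proof (rule card_sym_diff_add_card)
    show "finite (sym_diff X T)" using X(5) finite_edges[OF T'(4)] by simp
    show "k \<notin> sym_diff X T" using U'(8) T'(3) \<open>h \<noteq> k\<close> by blast
    show "U \<subseteq> insert k (sym_diff X T)" using U'(3) assms(4) by blast
  qed (rule U'(6))
  then show "card X' + card T + card U = card X + 4" using shortened_cycle(4)[OF T] by linarith
qed

lemma rainbow_4_tuple_if_disjoint_shortcuts:
  assumes T: "shortcut X h T" and U: "shortcut X k U" and "h \<noteq> k" "T \<inter> U = {}" "card chords = 2"
  shows "\<exists>As. rainbow_4_tuple cyclic c (2 * m + 2) As"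
proof -
  let ?X' = "sym_diff (sym_diff X T) U"
  note X' = twice_shortened_cycle[OF T U assms(3,4)]
  obtain Y Z where triple: "triple X Y Z" using exists_triple_with[OF shortcutD(1)[OF T]] by blast
  show ?thesis
  proof (rule rainbow_4_tuple_if_modified_cycles[OF triple, of ?X' Y Z])
    show "cyclic A \<and> inj_on c A" if "A \<in> {?X', Y, Z}" for A
      using that X'(1,2) triple_cycles[OF triple] cyclesD(6,7) by blast
    show "of_bool (g \<in> ?X') + of_bool (g \<in> Y) + of_bool (g \<in> Z) \<le> (1 :: nat)" if "g \<in> chords" for g
      using chord_notin_cycle[OF that] triple_cycles[OF triple] by simp
    show "card ?X' + card Y + card Z + card chords \<le> 2 * card S"
      using card_triple[OF triple] X'(4) three_le_card_shortcut[OF T] three_le_card_shortcut[OF U]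
        assms(5) by linarith
  qed (use X'(3) shortcutD(2)[OF T] shortcutD(2)[OF U] in auto)
qed

lemma triangle_shortcut:
  assumes T: "shortcut X h T" and "card T = 3" and e: "e \<in> T" "e \<noteq> h"
  shows "apex h \<in> en e" "en e \<subseteq> insert (apex h) (en h)"
proof -
  note T' = shortcutD[OF T]
  have apex_in: "apex h \<in> en f" if f: "f \<in> T" "f \<noteq> h" for f
  proof -
    have "apex h \<in> support en T" using apex(3)[OF T'(2)] T'(7) by (auto simp: support_def)
    then have "2 \<le> card {g\<in>T. apex h \<in> en g}"
      using two_le_degree_even_set[OF T'(4,5)] by (simp add: degree_eq[OF T'(4)])
    moreover have "{g\<in>T. apex h \<in> en g} \<subseteq> T - {h}" using apex(4)[OF T'(2)] by blast
    moreover have "card (T - {h}) = 2" using \<open>card T = 3\<close> T'(6) by simp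
    ultimately have "{g\<in>T. apex h \<in> en g} = T - {h}"
      using finite_edges[OF T'(4)] by (intro card_seteq) auto
    then show ?thesis using f by blast
  qed
  show apex_e: "apex h \<in> en e" by (rule apex_in[OF e])
  have eE: "e \<in> E" using e(1) T'(4) by blast
  obtain x where x: "en e = {apex h, x}" "x \<noteq> apex h" using other_end[OF eE apex_e] .
  obtain f where f: "f \<in> T" "f \<noteq> e" "x \<in> en f"
    using even_set_other_edge[OF T'(4,5) e(1), of x] x by auto
  have "f = h"
  proof (rule ccontr)
    assume "f \<noteq> h"
    have "f \<in> E" using f(1) T'(4) by blast
    moreover have "apex h \<in> en f" by (rule apex_in[OF f(1) \<open>f \<noteq> h\<close>])
    ultimately obtain u where "en f = {apex h, u}" by (rule other_end)
    then have "en f = en e" using f(3) x by auto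
    then show False using ends_eqD[OF \<open>f \<in> E\<close> eE] f(2) by blast
  qed
  then show "en e \<subseteq> insert (apex h) (en h)" using f(3) x(1) by auto
qed

text \<open>A common edge would join the two apices, so that \<open>h\<close> would have an end of degree three and
  both its ends would lie on a second cycle.\<close>

lemma triangle_shortcuts_disjoint:
  assumes T: "shortcut X h T" "card T = 3" and U: "shortcut X k U" "card U = 3" and "h \<noteq> k"
    and unique: "\<And>W. W \<in> cycles \<Longrightarrow> en h \<subseteq> support en W \<Longrightarrow> W = X"
  shows "T \<inter> U = {}"
proof (rule ccontr)
  assume "T \<inter> U \<noteq> {}"
  then obtain e where e: "e \<in> T" "e \<in> U" by blast
  note T' = shortcutD[OF T(1)] and U' = shortcutD[OF U(1)]
  have "e \<noteq> h" "e \<noteq> k" using e T'(3,8) U'(3,8) \<open>h \<noteq> k\<close> by auto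
  have "apex k \<in> en e" by (rule triangle_shortcut(1)[OF U e(2) \<open>e \<noteq> k\<close>])
  moreover have "apex h \<noteq> apex k" using inj_on_apex T'(2) U'(2) \<open>h \<noteq> k\<close> by (auto dest: inj_onD)
  ultimately have "apex k \<in> en h" using triangle_shortcut(2)[OF T e(1) \<open>e \<noteq> h\<close>] by auto
  then obtain b where b: "en h = {apex k, b}" using other_end[OF chordsD(1)[OF T'(2)]] by blast
  then have "b \<in> VS" using chordsD(3)[OF T'(2)] by auto
  then obtain W where "W \<in> cycles" "W \<noteq> X" "apex k \<in> support en W" "b \<in> support en W"
    using another_cycle_through_branch_vertex[OF apex(2)[OF U'(2)]] T'(1) by blast
  then show False using unique[of W] b by auto
qed

lemma rainbow_4_tuple_if_two_chords:
  assumes chords: "h \<in> chords" "k \<in> chords" "h \<noteq> k" "card chords = 2"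
  shows "\<exists>As. rainbow_4_tuple cyclic c (2 * m + 2) As"
proof (cases "\<exists>X\<in>cycles. \<exists>W\<in>cycles. X \<noteq> W \<and> en h \<subseteq> support en X \<and> en k \<subseteq> support en W")
  case True
  then obtain X W where XW: "X \<in> cycles" "W \<in> cycles" "X \<noteq> W" "en h \<subseteq> support en X"
    "en k \<subseteq> support en W"
    by blast
  obtain T where T: "shortcut X h T" using exists_shortcut[OF XW(1) chords(1) XW(4)] by blast
  obtain U where U: "shortcut W k U" using exists_shortcut[OF XW(2) chords(2) XW(5)] by blast
  show ?thesis by (rule rainbow_4_tuple_if_shortcuts_of_different_cycles[OF T U XW(3) chords(3,4)])
next
  case False
  obtain X where X: "X \<in> cycles" "en h \<subseteq> support en X"
    using cycle_through_chord_ends[OF chords(1)] by blast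
  obtain W where W: "W \<in> cycles" "en k \<subseteq> support en W"
    using cycle_through_chord_ends[OF chords(2)] by blast
  have "X = W" using False X W by metis
  then have k: "en k \<subseteq> support en X" using W(2) by simp
  obtain T where T: "shortcut X h T" using exists_shortcut[OF X(1) chords(1) X(2)] by blast
  obtain U where U: "shortcut X k U" using exists_shortcut[OF X(1) chords(2) k] by blast
  consider "card chords + 2 \<le> card T" | "card chords + 2 \<le> card U" | "card T = 3" "card U = 3"
    using three_le_card_shortcut[OF T] three_le_card_shortcut[OF U] chords(4) by linarith
  then show ?thesis
  proof cases
    case 1
    then show ?thesis by (rule rainbow_4_tuple_if_long_shortcut[OF T])
  next
    case 2
    then show ?thesis by (rule rainbow_4_tuple_if_long_shortcut[OF U])
  next
    case 3
    have "W = X" if "W \<in> cycles" "en h \<subseteq> support en W" for W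
      using False that X(1) k by metis
    then have "T \<inter> U = {}" by (rule triangle_shortcuts_disjoint[OF T 3(1) U 3(2) chords(3)])
    then show ?thesis by (rule rainbow_4_tuple_if_disjoint_shortcuts[OF T U chords(3) _ chords(4)])
  qed
qed

theorem rainbow_4_tuple_if_no_free_chord: "\<exists>As. rainbow_4_tuple cyclic c (2 * m + 2) As"
proof -
  consider "card chords = 0" | "card chords = 1" | "card chords = 2"
    using card_chords_le by linarith
  then show ?thesis
  proof cases
    case 1
    obtain X Y Z where triple: "triple X Y Z" using exists_triple by blast
    show ?thesis
    proof (rule rainbow_4_tuple_if_modified_cycles[OF triple, of X Y Z])
      show "cyclic A \<and> inj_on c A" if "A \<in> {X, Y, Z}" for A
        using that triple_cycles[OF triple] cyclesD(6,7) by blast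
      show "card X + card Y + card Z + card chords \<le> 2 * card S"
        using card_triple[OF triple] 1 by simp
    qed (use 1 finite_chords in auto)
  next
    case 2
    then obtain h where h: "h \<in> chords" by (auto simp: card_1_singleton_iff)
    then obtain X where "X \<in> cycles" "en h \<subseteq> support en X" using cycle_through_chord_ends by blast
    then obtain T where T: "shortcut X h T" using exists_shortcut h by blast
    have "card chords + 2 \<le> card T" using three_le_card_shortcut[OF T] 2 by simp
    then show ?thesis by (rule rainbow_4_tuple_if_long_shortcut[OF T])
  next
    case 3
    then obtain h k where "h \<in> chords" "k \<in> chords" "h \<noteq> k" by (auto simp: card_2_iff)
    then show ?thesis using 3 by (rule rainbow_4_tuple_if_two_chords)
  qed
qed

end

theorem (in rainbow_theta) rainbow_4_tuple_if_theta: "\<exists>As. rainbow_4_tuple cyclic c (2 * m + 2) As"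
proof -
  obtain C where C: "simple_cycle C" "inj_on c C" "C \<inter> S = {}" "\<forall>h\<in>C. en h \<subseteq> VS \<longrightarrow> partner h \<in> S"
    using rainbow_cycle_outside by blast
  then interpret rainbow_theta_with_cycle V E en c m S C by unfold_locales auto
  show ?thesis
  proof (cases "\<exists>X\<in>cycles. \<exists>h\<in>chords. en h \<subseteq> support en X \<and> partner h \<notin> X")
    case True
    then show ?thesis using rainbow_4_tuple_if_free_chord by blast
  next
    case False
    then interpret rainbow_theta_without_free_chord V E en c m S C by unfold_locales auto
    show ?thesis by (rule rainbow_4_tuple_if_no_free_chord)
  qed
qed

section \<open>Graphic and cographic matroids\<close>

theorem (in coloured_graph) rainbow_4_tuple_exists:
  assumes "V \<noteq> {}"
  shows "\<exists>As. rainbow_4_tuple cyclic c (2 * m + 2) As"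
proof (cases "\<exists>S\<subseteq>E. inj_on c S \<and> bicyclic en S")
  case False
  then interpret rainbow_unicyclic_graph V E en c m by unfold_locales auto
  show ?thesis by (rule rainbow_4_tuple_if_unicyclic[OF assms])
next
  case True
  define rainbow_bicyclic where "rainbow_bicyclic S \<longleftrightarrow> S \<subseteq> E \<and> inj_on c S \<and> bicyclic en S" for S
  obtain S\<^sub>0 where "rainbow_bicyclic S\<^sub>0" using True by (auto simp: rainbow_bicyclic_def)
  then obtain S where S: "rainbow_bicyclic S" and least: "\<And>Q. rainbow_bicyclic Q \<Longrightarrow> card S \<le> card Q"
    using ex_has_least_nat[of rainbow_bicyclic S\<^sub>0 card] by blast
  have S': "S \<subseteq> E" "inj_on c S" using S by (simp_all add: rainbow_bicyclic_def)
  show ?thesis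
  proof (cases "\<exists>X Y. X \<subseteq> S \<and> Y \<subseteq> S \<and> cyclic X \<and> cyclic Y \<and> X \<inter> Y = {}")
    case True
    then obtain X Y where XY: "X \<subseteq> S" "Y \<subseteq> S" "cyclic X" "cyclic Y" "X \<inter> Y = {}" by blast
    have fin: "finite X" "finite Y" using XY(3,4) finite_edges by (auto simp: cyclic_def)
    have "card X + card Y = card (X \<union> Y)" using card_Un_disjoint[OF fin XY(5)] by simp
    also have "\<dots> \<le> card S" using XY(1,2) finite_edges[OF S'(1)] by (intro card_mono) auto
    also have "\<dots> \<le> m" by (rule card_rainbow_le[OF S'])
    finally show ?thesis
      using XY S'(2)
      by (intro exI[of _ "[X, X, Y, Y]"] rainbow_4_tuple_doubled_pair) (auto intro: inj_on_subset)
  next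
    case False
    interpret rainbow_theta V E en c m S
      by unfold_locales (use S least False in \<open>auto simp: rainbow_bicyclic_def\<close>)
    show ?thesis by (rule rainbow_4_tuple_if_theta)
  qed
qed

lemma simple_graph_if_represents:
  assumes "matroid M" "simple_matroid M" and rep: "represents M V en"
  shows "simple_graph V (ground M) en"
proof -
  interpret matroid M by (rule assms(1))
  have edge: "is_edge (en e) \<and> en e \<subseteq> V" if "e \<in> ground M" for e
    using rep that by (auto simp: represents_def)
  have no_short: "T = {}" if "T \<subseteq> ground M" "even_set en T" "card T \<le> 2" for T
    using simple_matroid_indep[OF assms(2) that(1,3)] rep that unfolding represents_def forest_def
    by blast
  show ?thesis
  proof
    show "finite V" using rep by (simp add: represents_def)
    show "en e \<subseteq> V" if "e \<in> ground M" for e using edge[OF that] by blast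
    show "card (en e) = 2" if e: "e \<in> ground M" for e
    proof (rule ccontr)
      assume "card (en e) \<noteq> 2"
      then obtain a where "en e = {a}"
        using edge[OF e] by (auto simp: is_edge_def card_insert_if split: if_splits)
      then have "{e} \<inter> cut en {v} = {}" for v by (auto simp: cut_def)
      then have "even_set en {e}" unfolding even_set_def degree_def by simp
      then show False using no_short[of "{e}"] e by simp
    qed
    show "inj_on en (ground M)"
    proof (rule inj_onI, rule ccontr)
      fix e f assume ef: "e \<in> ground M" "f \<in> ground M" "en e = en f" "e \<noteq> f"
      have "{e, f} \<inter> cut en {v} = (if e \<in> cut en {v} then {e, f} else {})" for v
        using ef(3) by (auto simp: cut_def)
      then have "even (degree en {e, f} v)" for v using ef(4) by (simp add: degree_def)
      then have "even_set en {e, f}" by (simp add: even_set_def)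
      then show False using no_short[of "{e, f}"] ef by simp
    qed
  qed
qed

context matroid
begin

lemma graphic_short_rainbow_circuit_4_tuple:
  assumes simple: "simple_matroid M" and graphic: "graphic M"
    and colouring: "colouring M (matroid_rank M + 1) c" "two_uniform M (matroid_rank M + 1) c"
  shows "\<exists>C. short_rainbow_circuit_4_tuple M c C"
proof -
  obtain V :: "nat set" and en where rep: "represents M V en"
    and conn: "connected_edges V (ground M) en"
    using connected_representation[OF graphic finite_ground] by blast
  obtain B where B: "basis M B" using indep_extends_to_basis[OF indep_empty] by blast
  have "finite B" using basis_subset_ground[OF B] finite_ground by (rule finite_subset)
  then have card_V: "card V = matroid_rank M + 1"
    using card_vertices_eq_Suc_card_basis[OF rep conn B basis_subset_ground[OF B]] card_basis[OF B]
    by simp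
  interpret simple_graph V "ground M" en
    by (rule simple_graph_if_represents[OF matroid_axioms simple rep])
  interpret two_uniform_colouring "ground M" c "matroid_rank M + 1"
    by (rule two_uniform_colouring_ground[OF colouring])
  interpret coloured_graph V "ground M" en c "matroid_rank M + 1"
    by unfold_locales (simp add: card_V)
  have "V \<noteq> {}" using rep by (simp add: represents_def)
  moreover have bound: "2 * (matroid_rank M + 1) + 2 = 2 * matroid_rank M + 4" by simp
  ultimately obtain As where As: "rainbow_4_tuple cyclic c (2 * matroid_rank M + 4) As"
    using rainbow_4_tuple_exists unfolding bound by blast
  have "A \<subseteq> ground M \<and> A \<notin> indeps M" if "cyclic A" for A
    using that rep by (auto simp: cyclic_def represents_def forest_def)
  then show ?thesis
    by (rule short_rainbow_circuit_4_tuple_if_dependent[OF rainbow_4_tuple_mono[OF As]])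
qed

lemma coloured_multigraph_if_dual_represented:
  assumes simple: "simple_matroid M"
    and rep: "represents (dual M) V en" and conn: "connected_edges V (ground M) en"
    and colouring: "colouring M (matroid_rank M + 1) c" "two_uniform M (matroid_rank M + 1) c"
  shows "coloured_multigraph (ground M) c (matroid_rank M + 1) V en"
proof -
  have ground: "ground (dual M) = ground M" by (simp add: dual_def)
  interpret two_uniform_colouring "ground M" c "matroid_rank M + 1"
    by (rule two_uniform_colouring_ground[OF colouring])
  show ?thesis
  proof
    show "finite V" "\<And>e. e \<in> ground M \<Longrightarrow> is_edge (en e)"
      using rep by (auto simp: represents_def ground)
    obtain B where B: "basis M B" using indep_extends_to_basis[OF indep_empty] by blast
    have sub: "B \<subseteq> ground M" by (rule basis_subset_ground[OF B])
    have "card (ground M - B) = 2 * (matroid_rank M + 1) - matroid_rank M"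
      using card_Diff_subset[OF finite_subset[OF sub finite_ground] sub] card_E card_basis[OF B] by simp
    moreover have "card V = card (ground M - B) + 1"
      using card_vertices_eq_Suc_card_basis[OF rep _ basis_dual[OF B]] conn finite_ground
      by (simp add: ground)
    ultimately show "card V = matroid_rank M + 1 + 2" by simp
    show "3 \<le> card (ground M \<inter> cut en X)" if "X \<subseteq> V" "X \<noteq> {}" "X \<noteq> V" for X
    proof -
      have "ground M \<inter> cut en X \<notin> indeps M"
        using conn that
        by (intro cut_dependent_if_dual_represented[OF rep]) (auto simp: connected_edges_def)
      then have "\<not> card (ground M \<inter> cut en X) \<le> 2" using simple_matroid_indep[OF simple] by blast
      then show ?thesis by simp
    qed
  qed
qed

lemma cographic_short_rainbow_circuit_4_tuple:
  assumes simple: "simple_matroid M" and cographic: "cographic M"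
    and colouring: "colouring M (matroid_rank M + 1) c" "two_uniform M (matroid_rank M + 1) c"
  shows "\<exists>C. short_rainbow_circuit_4_tuple M c C"
proof -
  have ground: "ground (dual M) = ground M" by (simp add: dual_def)
  obtain V :: "nat set" and en where rep: "represents (dual M) V en"
    and conn: "connected_edges V (ground M) en"
    using connected_representation[of "dual M"] cographic finite_ground
    unfolding cographic_def ground by blast
  interpret coloured_multigraph "ground M" c "matroid_rank M + 1" V en
    by (rule coloured_multigraph_if_dual_represented[OF simple rep conn colouring])
  have bound: "2 * (matroid_rank M + 1) + 2 = 2 * matroid_rank M + 4" by simp
  from rainbow_4_tuple_of_edge_cuts[unfolded bound]
  obtain As where As: "rainbow_4_tuple edge_cut c (2 * matroid_rank M + 4) As" ..
  have "A \<subseteq> ground M \<and> A \<notin> indeps M" if "edge_cut A" for A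
    using that cut_dependent_if_dual_represented[OF rep] by (auto simp: edge_cut_def)
  then show ?thesis
    by (rule short_rainbow_circuit_4_tuple_if_dependent[OF rainbow_4_tuple_mono[OF As]])
qed

end

theorem theorem3:
  fixes M :: "'a pre_matroid" and c :: "'a \<Rightarrow> nat"
  assumes "matroid M"
    and "simple_matroid M"
    and "graphic M \<or> cographic M"
    and "colouring M (matroid_rank M + 1) c"
    and "two_uniform M (matroid_rank M + 1) c"
  shows "\<exists>C. short_rainbow_circuit_4_tuple M c C"
proof -
  interpret matroid M by (rule assms(1))
  show ?thesis
    using assms(3)
  proof
    assume "graphic M"
    then show ?thesis by (rule graphic_short_rainbow_circuit_4_tuple[OF assms(2) _ assms(4,5)])
  next
    assume "cographic M"
    then show ?thesis by (rule cographic_short_rainbow_circuit_4_tuple[OF assms(2) _ assms(4,5)])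
  qed
qed

end
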